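(* Let $n\ge 1$ and real parameters $\alpha,\beta,\gamma$ be such that the integrals below converge. Then \[ \left\langle x_1^{-2}\right\rangle_{n,\alpha,\beta,\gamma} = \frac{\alpha+\beta+(n-1)\gamma-1}{(\alpha-1)(\alpha-2)}\cdot\left(\alpha+\beta - 2 + \frac{\gamma(n-1)(\alpha+\beta+n\gamma-1)}{\alpha+\gamma -1}\right). \]
   Context: Define the weight on $[0,1]^n$ \[w_{n,\alpha,\beta,\gamma}(x) = \prod_{i<j}|x_i-x_j|^{2\gamma}\prod_{i=1}^{n}x_i^{\alpha-1}\prod_{i=1}^{n}(1-x_i)^{\beta-1},\] and for a function $f$ define the average \[\left\langle f(x_1,\ldots,x_n)\right\rangle_{n,\alpha,\beta,\gamma} = \frac{\int_0^{1}\cdots\int_{0}^{1}f(x_1,\ldots,x_n)\,w_{n,\alpha,\beta,\gamma}(x)\,dx}{\int_0^{1}\cdots\int_{0}^{1}w_{n,\alpha,\beta,\gamma}(x)\,dx}\] (the Jacobi Ensemble average). *)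

theory Defs
  imports "HOL-Analysis.Analysis"
begin

text \<open>Points of [0,1]^n are functions x :: nat => real, with coordinates x 0, ..., x (n-1)
  (the paper's x_1, ..., x_n). The measure is Lebesgue measure on [0,1]^n, realised as the
  finite product of Lebesgue measure restricted to [0,1].\<close>

definition jacobi_measure :: "nat \<Rightarrow> (nat \<Rightarrow> real) measure" where
  "jacobi_measure n = PiM {..<n} (\<lambda>_. restrict_space lborel {0..1::real})"

definition jacobi_weight :: "nat \<Rightarrow> real \<Rightarrow> real \<Rightarrow> real \<Rightarrow> (nat \<Rightarrow> real) \<Rightarrow> real" where
  "jacobi_weight n \<alpha> \<beta> \<gamma> x =
     (\<Prod>i<n. \<Prod>j\<in>{i<..<n}. \<bar>x i - x j\<bar> powr (2 * \<gamma>)) *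
     (\<Prod>i<n. x i powr (\<alpha> - 1)) *
     (\<Prod>i<n. (1 - x i) powr (\<beta> - 1))"

definition jacobi_avg :: "nat \<Rightarrow> real \<Rightarrow> real \<Rightarrow> real \<Rightarrow> ((nat \<Rightarrow> real) \<Rightarrow> real) \<Rightarrow> real" where
  "jacobi_avg n \<alpha> \<beta> \<gamma> f =
     (\<integral>x. f x * jacobi_weight n \<alpha> \<beta> \<gamma> x \<partial>jacobi_measure n) /
     (\<integral>x. jacobi_weight n \<alpha> \<beta> \<gamma> x \<partial>jacobi_measure n)"

end

theory Submission
  imports Defs "HOL-Probability.Infinite_Product_Measure"
begin

text \<open>
  Substitute \<open>x i + t * v (x i)\<close> for all coordinates simultaneously, where \<open>v\<close> vanishes at 0 and 1.
  If 0 and 1 are adjoined to the coordinates as two fixed nodes, the weight is a product of powers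
  of distances between nodes, and the substitution multiplies every distance by \<open>1 + t * D z w\<close>,
  where \<open>D\<close> is the divided difference of \<open>v\<close>. Together with the Jacobian determinant this multiplies
  the weight by \<open>exp (t * E + O(t\<^sup>2))\<close> with a bounded divergence \<open>E\<close>, whatever the exponents are,
  and no integration by parts across the diagonals is needed. As the integral does not depend on
  \<open>t\<close> and \<open>1 + s \<le> exp s\<close>, the weighted integral of \<open>E\<close> vanishes.

  Approximating the fields \<open>1 - z\<close> and \<open>1 / z - 1\<close> by \<open>z * (1 - z) / (z + \<epsilon>)\<close> and
  \<open>z * (1 - z) / (z\<^sup>2 + \<epsilon>)\<close> yields three linear relations between the averages of \<open>1 / x 0\<close>,
  \<open>1 / (x 0)\<^sup>2\<close> and \<open>1 / (x 0 * x 1)\<close>: from \<open>1 - z\<close> with the given weight and with the weight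
  divided by \<open>x 0\<close>, and from \<open>1 / z - 1\<close> with the given weight. They determine the average of
  \<open>1 / (x 0)\<^sup>2\<close>, because convergence of the integrals forces \<open>\<alpha> > 2\<close> and, for \<open>n \<ge> 2\<close>,
  \<open>\<gamma> > -1/2\<close>.
\<close>

subsection \<open>Finite product measures\<close>

lemma indicator_PiE:
  assumes "finite I" "x \<in> extensional I"
  shows "indicator (Pi\<^sub>E I A) x = (\<Prod>i\<in>I. indicator (A i) (x i) :: 'b :: comm_semiring_1)"
proof (cases "x \<in> Pi\<^sub>E I A")
  case True
  then have "(\<Prod>i\<in>I. indicator (A i) (x i) :: 'b) = (\<Prod>i\<in>I. 1)"
    by (intro prod.cong) (auto simp: PiE_iff)
  with True show ?thesis by simp
next
  case False
  with assms(2) obtain i where "i \<in> I" "x i \<notin> A i"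
    by (auto simp: PiE_iff)
  then have "(\<Prod>i\<in>I. indicator (A i) (x i) :: 'b) = 0"
    using assms(1) by (intro prod_zero) (auto intro!: bexI[of _ i])
  with False show ?thesis by simp
qed

context product_sigma_finite
begin

lemma PiM_density:
  assumes "finite I"
    and [measurable]: "\<And>i. i \<in> I \<Longrightarrow> f i \<in> borel_measurable (M i)"
    and "\<And>i. sigma_finite_measure (density (M i) (f i))"
  shows "PiM I (\<lambda>i. density (M i) (f i)) = density (PiM I M) (\<lambda>x. \<Prod>i\<in>I. f i (x i))"
proof -
  interpret density: product_sigma_finite "\<lambda>i. density (M i) (f i)"
    by (rule product_sigma_finite.intro) fact
  have "density (PiM I M) (\<lambda>x. \<Prod>i\<in>I. f i (x i)) = PiM I (\<lambda>i. density (M i) (f i))"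
  proof (rule density.PiM_eqI[OF \<open>finite I\<close>])
    show "sets (density (PiM I M) (\<lambda>x. \<Prod>i\<in>I. f i (x i))) = sets (PiM I (\<lambda>i. density (M i) (f i)))"
      by (simp cong: sets_PiM_cong)
    fix A assume "\<And>i. i \<in> I \<Longrightarrow> A i \<in> sets (density (M i) (f i))"
    then have sets [measurable]: "\<And>i. i \<in> I \<Longrightarrow> A i \<in> sets (M i)" by simp
    have "emeasure (density (PiM I M) (\<lambda>x. \<Prod>i\<in>I. f i (x i))) (Pi\<^sub>E I A)
        = (\<integral>\<^sup>+x. (\<Prod>i\<in>I. f i (x i)) * indicator (Pi\<^sub>E I A) x \<partial>PiM I M)"
      using \<open>finite I\<close> sets
      by (intro emeasure_density sets_PiM_I_finite borel_measurable_prod_ennreal) auto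
    also have "\<dots> = (\<integral>\<^sup>+x. (\<Prod>i\<in>I. f i (x i) * indicator (A i) (x i)) \<partial>PiM I M)"
      using \<open>finite I\<close>
      by (intro nn_integral_cong) (simp add: indicator_PiE space_PiM PiE_iff prod.distrib)
    also have "\<dots> = (\<Prod>i\<in>I. \<integral>\<^sup>+z. f i z * indicator (A i) z \<partial>M i)"
      by (rule product_nn_integral_prod[OF \<open>finite I\<close>]) simp
    also have "\<dots> = (\<Prod>i\<in>I. emeasure (density (M i) (f i)) (A i))"
      by (intro prod.cong) (auto simp: emeasure_density)
    finally show "emeasure (density (PiM I M) (\<lambda>x. \<Prod>i\<in>I. f i (x i))) (Pi\<^sub>E I A)
        = (\<Prod>i\<in>I. emeasure (density (M i) (f i)) (A i))" .
  qed
  then show ?thesis ..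
qed

lemma AE_PiM_insert:
  assumes "finite I" "i \<notin> I"
    and [measurable]: "Measurable.pred (PiM (insert i I) M) P"
    and AE_section: "\<And>x. x \<in> space (PiM I M) \<Longrightarrow> AE y in M i. P (x(i := y))"
  shows "AE x in PiM (insert i I) M. P x"
proof -
  have "(\<integral>\<^sup>+x. indicator {x. \<not> P x} x \<partial>PiM (insert i I) M)
      = (\<integral>\<^sup>+x. \<integral>\<^sup>+y. indicator {x. \<not> P x} (x(i := y)) \<partial>M i \<partial>PiM I M)"
    using assms(1,2) by (rule product_nn_integral_insert) measurable
  also have "\<dots> = (\<integral>\<^sup>+x. \<integral>\<^sup>+y. 0 \<partial>M i \<partial>PiM I M)"
  proof (rule nn_integral_cong, rule nn_integral_cong_AE)
    fix x assume "x \<in> space (PiM I M)"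
    from AE_section[OF this] show "AE y in M i. indicator {x. \<not> P x} (x(i := y)) = (0 :: ennreal)"
      by eventually_elim simp
  qed
  finally have "(\<integral>\<^sup>+x. indicator {x. \<not> P x} x \<partial>PiM (insert i I) M) = 0"
    by simp
  then have "AE x in PiM (insert i I) M. indicator {x. \<not> P x} x = (0 :: ennreal)"
    by (subst (asm) nn_integral_0_iff_AE) simp_all
  then show ?thesis
    by eventually_elim (simp add: indicator_def split: if_splits)
qed

lemma AE_integrable_fun_upd:
  fixes f :: "('i \<Rightarrow> 'a) \<Rightarrow> real"
  assumes "finite I" "i \<notin> I"
    and integrable: "integrable (PiM (insert i I) M) f"
  shows "AE x in PiM I M. integrable (M i) (\<lambda>y. f (x(i := y)))"
proof -
  have measurable_f [measurable]: "f \<in> borel_measurable (PiM (insert i I) M)"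
    using integrable by simp
  have measurable_upd: "(\<lambda>(x, y). x(i := y)) \<in> PiM I M \<Otimes>\<^sub>M M i \<rightarrow>\<^sub>M PiM (insert i I) M"
    by (rule measurable_add_dim)
  have measurable_pair: "(\<lambda>(x, y). f (x(i := y))) \<in> borel_measurable (PiM I M \<Otimes>\<^sub>M M i)"
    using measurable_compose[OF measurable_upd measurable_f] by (simp add: case_prod_beta)
  let ?N = "\<lambda>x. \<integral>\<^sup>+y. norm (f (x(i := y))) \<partial>M i"
  have "(\<integral>\<^sup>+x. ?N x \<partial>PiM I M) = (\<integral>\<^sup>+x. norm (f x) \<partial>PiM (insert i I) M)"
    using assms(1,2) by (rule product_nn_integral_insert[symmetric]) measurable
  also have "\<dots> < \<infinity>"
    using integrable by (simp add: integrable_iff_bounded)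
  finally have "(\<integral>\<^sup>+x. ?N x \<partial>PiM I M) \<noteq> \<infinity>" by simp
  moreover have "?N \<in> borel_measurable (PiM I M)"
    using measurable_pair by (intro M.borel_measurable_nn_integral) (simp add: case_prod_beta)
  ultimately have "AE x in PiM I M. ?N x \<noteq> \<infinity>"
    by (rule nn_integral_PInf_AE[rotated])
  with AE_space show ?thesis
  proof eventually_elim
    case (elim x)
    then have "(\<lambda>y. f (x(i := y))) \<in> borel_measurable (M i)"
      using measurable_Pair2[OF measurable_pair] by simp
    with elim show ?case
      by (simp add: integrable_iff_bounded top.not_eq_extremum)
  qed
qed

end

subsection \<open>Reparametrizations of the unit interval\<close>

abbreviation unit_lborel :: "real measure" where
  "unit_lborel \<equiv> restrict_space lborel {0..1}"

lemma space_unit_lborel: "space unit_lborel = {0..1}"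
  by (simp add: space_restrict_space)

lemma prob_space_unit_lborel: "prob_space unit_lborel"
  by (rule prob_spaceI) (simp add: space_unit_lborel emeasure_restrict_space)

lemma borel_measurable_unit_lborelI:
  fixes f :: "real \<Rightarrow> 'a :: topological_space"
  assumes "continuous_on {0..1} f"
  shows "f \<in> borel_measurable unit_lborel"
proof -
  have "f \<in> borel_measurable (restrict_space borel {0..1})"
    using assms by (rule borel_measurable_continuous_on_restrict)
  then show ?thesis
    using measurable_cong_sets[of unit_lborel "restrict_space borel {0..1}" borel borel]
    by (simp add: sets_restrict_space)
qed

lemma measurable_unit_product_coordinate:
  assumes "i \<in> I"
  shows "(\<lambda>x. x i) \<in> borel_measurable (PiM I (\<lambda>_. unit_lborel))"
proof -
  have "(\<lambda>x. x i) \<in> PiM I (\<lambda>_. unit_lborel) \<rightarrow>\<^sub>M unit_lborel"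
    using assms by (rule measurable_component_singleton)
  then show ?thesis
    by (rule measurable_compose) (rule borel_measurable_unit_lborelI, rule continuous_on_id)
qed

lemma product_sigma_finite_unit_lborel: "product_sigma_finite (\<lambda>_. unit_lborel)"
  by (rule product_sigma_finite.intro) (rule prob_space_imp_sigma_finite[OF prob_space_unit_lborel])

locale unit_reparametrization =
  fixes g g' :: "real \<Rightarrow> real"
  assumes has_deriv: "z \<in> {0..1} \<Longrightarrow> (g has_real_derivative g' z) (at z)"
    and continuous_deriv: "continuous_on {0..1} g'"
    and deriv_nonneg: "z \<in> {0..1} \<Longrightarrow> 0 \<le> g' z"
    and fixes_endpoints: "g 0 = 0" "g 1 = 1"
begin

lemma maps_unit:
  assumes "z \<in> {0..1}"
  shows "g z \<in> {0..1}"
proof -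
  have "g 0 \<le> g z" "g z \<le> g 1"
    using assms has_deriv deriv_nonneg
    by (auto intro!: DERIV_nonneg_imp_nondecreasing[where f = g] dest: order_trans)
  then show ?thesis by (simp add: fixes_endpoints)
qed

lemma measurable_map: "g \<in> unit_lborel \<rightarrow>\<^sub>M unit_lborel"
proof (rule measurable_restrict_space2)
  have "continuous_on {0..1} g"
    using has_deriv by (rule has_real_derivative_imp_continuous_on)
  then show "g \<in> unit_lborel \<rightarrow>\<^sub>M lborel"
    by (simp add: borel_measurable_unit_lborelI)
qed (auto simp: space_unit_lborel dest: maps_unit)

lemma measurable_deriv: "g' \<in> borel_measurable unit_lborel"
  by (rule borel_measurable_unit_lborelI[OF continuous_deriv])

lemma distr_density_unit_lborel: "distr (density unit_lborel g') unit_lborel g = unit_lborel"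
proof (rule measure_eqI)
  fix B assume "B \<in> sets (distr (density unit_lborel g') unit_lborel g)"
  then have [measurable]: "B \<in> sets unit_lborel" "B \<in> sets borel" and "B \<subseteq> {0..1}"
    by (auto simp: sets_restrict_space)
  note [measurable] = measurable_map measurable_deriv
  have "emeasure (distr (density unit_lborel g') unit_lborel g) B
      = emeasure (density unit_lborel g') (g -` B \<inter> space unit_lborel)"
    by (subst emeasure_distr) simp_all
  also have "\<dots> = (\<integral>\<^sup>+z. ennreal (g' z) * indicator (g -` B \<inter> space unit_lborel) z \<partial>unit_lborel)"
    by (intro emeasure_density) measurable
  also have "\<dots> = (\<integral>\<^sup>+z. ennreal (indicator B (g z) * g' z * indicator {0..1} z) \<partial>lborel)"
    by (subst nn_integral_restrict_space)
      (auto simp: space_unit_lborel indicator_def intro!: nn_integral_cong)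
  also have "\<dots> = (\<integral>\<^sup>+z. ennreal (indicator B z * indicator {g 0..g 1} z) \<partial>lborel)"
    by (rule nn_integral_substitution[symmetric])
      (auto simp: set_borel_measurable_def has_deriv continuous_deriv deriv_nonneg)
  also have "\<dots> = (\<integral>\<^sup>+z. indicator B z \<partial>lborel)"
    using \<open>B \<subseteq> {0..1}\<close> by (intro nn_integral_cong) (auto simp: fixes_endpoints indicator_def)
  also have "\<dots> = emeasure unit_lborel B"
    using \<open>B \<subseteq> {0..1}\<close> by (simp add: emeasure_restrict_space)
  finally show "emeasure (distr (density unit_lborel g') unit_lborel g) B
      = emeasure unit_lborel B" .
qed simp

lemma distr_density_PiM:
  assumes "finite I"
  shows "distr (density (PiM I (\<lambda>_. unit_lborel)) (\<lambda>x. \<Prod>i\<in>I. ennreal (g' (x i))))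
    (PiM I (\<lambda>_. unit_lborel)) (compose I g) = PiM I (\<lambda>_. unit_lborel)"
proof -
  note [measurable] = measurable_map measurable_deriv
  have prob: "prob_space (density unit_lborel g')"
  proof (rule prob_space_distrD)
    show "g \<in> density unit_lborel g' \<rightarrow>\<^sub>M unit_lborel"
      by simp
    show "prob_space (distr (density unit_lborel g') unit_lborel g)"
      unfolding distr_density_unit_lborel by (rule prob_space_unit_lborel)
  qed
  have "density (PiM I (\<lambda>_. unit_lborel)) (\<lambda>x. \<Prod>i\<in>I. ennreal (g' (x i)))
      = PiM I (\<lambda>_. density unit_lborel g')"
    using assms prob_space_imp_sigma_finite[OF prob]
    by (intro product_sigma_finite.PiM_density[OF product_sigma_finite_unit_lborel, symmetric])
      simp_all
  also have "distr \<dots> (PiM I (\<lambda>_. unit_lborel)) (compose I g)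
      = PiM I (\<lambda>_. distr (density unit_lborel g') unit_lborel g)"
    by (intro distr_PiM_finite_prob_space' assms prob prob_space_unit_lborel) simp
  finally show ?thesis
    by (simp only: distr_density_unit_lborel)
qed

lemma integral_PiM_compose:
  fixes f :: "('i \<Rightarrow> real) \<Rightarrow> real"
  assumes "finite I" and [measurable]: "f \<in> borel_measurable (PiM I (\<lambda>_. unit_lborel))"
  shows "(\<integral>x. (\<Prod>i\<in>I. g' (x i)) * f (compose I g x) \<partial>PiM I (\<lambda>_. unit_lborel))
       = (\<integral>x. f x \<partial>PiM I (\<lambda>_. unit_lborel))"
proof -
  let ?P = "PiM I (\<lambda>_. unit_lborel)"
  note [measurable] = measurable_map measurable_deriv
  have [measurable]: "compose I g \<in> ?P \<rightarrow>\<^sub>M ?P"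
    unfolding compose_def by measurable
  have nonneg: "0 \<le> (\<Prod>i\<in>I. g' (x i))" if "x \<in> space ?P" for x
    using that deriv_nonneg by (intro prod_nonneg) (auto simp: space_PiM space_unit_lborel PiE_iff)
  have "density ?P (\<lambda>x. \<Prod>i\<in>I. ennreal (g' (x i))) = density ?P (\<lambda>x. ennreal (\<Prod>i\<in>I. g' (x i)))"
    using deriv_nonneg
    by (intro density_cong AE_I2 prod_ennreal) (auto simp: space_PiM space_unit_lborel PiE_iff)
  then have "(\<integral>x. f x \<partial>?P)
      = (\<integral>x. f x \<partial>distr (density ?P (\<lambda>x. ennreal (\<Prod>i\<in>I. g' (x i)))) ?P (compose I g))"
    using distr_density_PiM[OF \<open>finite I\<close>] by simp
  also have "\<dots> = (\<integral>x. f (compose I g x) \<partial>density ?P (\<lambda>x. ennreal (\<Prod>i\<in>I. g' (x i))))"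
    by (rule integral_distr) simp_all
  also have "\<dots> = (\<integral>x. (\<Prod>i\<in>I. g' (x i)) *\<^sub>R f (compose I g x) \<partial>?P)"
    by (rule integral_density) (auto simp: nonneg)
  finally show ?thesis by simp
qed

end

subsection \<open>Products of powers of distances between nodes\<close>

text \<open>The nodes \<open>n\<close> and \<open>n + 1\<close> are the endpoints 0 and 1, so that all three factors of the Jacobi
  weight are powers of distances between nodes.\<close>

definition node :: "nat \<Rightarrow> (nat \<Rightarrow> real) \<Rightarrow> nat \<Rightarrow> real" where
  "node n x j = (if j < n then x j else if j = n then 0 else 1)"

definition node_pairs :: "nat \<Rightarrow> (nat \<times> nat) set" where
  "node_pairs n = {(i, j). i < n \<and> j < n + 2 \<and> i \<noteq> j}"

definition power_product ::
    "nat \<Rightarrow> (nat \<Rightarrow> nat \<Rightarrow> real) \<Rightarrow> (nat \<times> nat) set \<Rightarrow> (nat \<Rightarrow> real) \<Rightarrow> real" where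
  "power_product n e P x = (\<Prod>(i, j)\<in>P. \<bar>node n x i - node n x j\<bar> powr e i j)"

abbreviation selberg_weight :: "nat \<Rightarrow> (nat \<Rightarrow> nat \<Rightarrow> real) \<Rightarrow> (nat \<Rightarrow> real) \<Rightarrow> real" where
  "selberg_weight n e \<equiv> power_product n e (node_pairs n)"

lemma finite_node_pairs [simp]: "finite (node_pairs n)"
  by (rule finite_subset[of _ "{..<n} \<times> {..<n + 2}"]) (auto simp: node_pairs_def)

lemma jacobi_measure_eq_PiM: "jacobi_measure n = PiM {..<n} (\<lambda>_. unit_lborel)"
  by (simp add: jacobi_measure_def)

lemma prob_space_jacobi_measure: "prob_space (jacobi_measure n)"
  unfolding jacobi_measure_def by (intro prob_space_PiM prob_space_unit_lborel)

lemma space_jacobi_measureD: "x \<in> space (jacobi_measure n) \<Longrightarrow> i < n \<Longrightarrow> x i \<in> {0..1}"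
  by (auto simp: jacobi_measure_def space_PiM space_unit_lborel PiE_iff)

lemma node_in_unit: "x \<in> space (jacobi_measure n) \<Longrightarrow> node n x j \<in> {0..1}"
  using space_jacobi_measureD by (simp add: node_def)

lemma measurable_coordinate: "i < n \<Longrightarrow> (\<lambda>x. x i) \<in> borel_measurable (jacobi_measure n)"
  unfolding jacobi_measure_eq_PiM by (simp add: measurable_unit_product_coordinate)

lemma measurable_node [measurable]: "(\<lambda>x. node n x j) \<in> borel_measurable (jacobi_measure n)"
  by (cases "j < n") (simp_all add: node_def measurable_coordinate)

lemma measurable_power_product [measurable]:
  "power_product n e P \<in> borel_measurable (jacobi_measure n)"
  unfolding power_product_def[abs_def] case_prod_beta by measurable

lemma power_product_nonneg: "0 \<le> power_product n e P x"
  unfolding power_product_def by (intro prod_nonneg) auto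

lemma power_product_pos:
  assumes "\<And>i j. (i, j) \<in> P \<Longrightarrow> node n x i \<noteq> node n x j"
  shows "0 < power_product n e P x"
  unfolding power_product_def using assms by (intro prod_pos) auto

lemma power_product_remove:
  assumes "finite P" "(i, j) \<in> P"
  shows "power_product n e P x
    = \<bar>node n x i - node n x j\<bar> powr e i j * power_product n e (P - {(i, j)}) x"
  using assms unfolding power_product_def by (subst prod.remove[of P "(i, j)"]) simp_all

text \<open>No condition on the exponents is needed since \<^term>\<open>0 powr s = 0\<close> even for \<open>s \<le> 0\<close>.\<close>

lemma selberg_weight_eq_0:
  assumes "i < n" "x i = 0"
  shows "selberg_weight n e x = 0"
proof -
  have "(i, n) \<in> node_pairs n" "node n x i = node n x n"
    using assms by (auto simp: node_pairs_def node_def)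
  then show ?thesis
    unfolding power_product_def by (intro prod_zero) (auto intro!: bexI[of _ "(i, n)"])
qed

lemma selberg_weight_cases:
  assumes "x \<in> space (jacobi_measure n)"
  obtains (zero) "selberg_weight n e x = 0" | (positive) "\<And>i. i < n \<Longrightarrow> 0 < x i"
  using space_jacobi_measureD[OF assms] selberg_weight_eq_0
  by (metis atLeastAtMost_iff order_le_less)

lemma selberg_weight_mult_cong:
  assumes "x \<in> space (jacobi_measure n)"
    and "(\<And>i. i < n \<Longrightarrow> 0 < x i) \<Longrightarrow> a = b"
  shows "selberg_weight n e x * a = selberg_weight n e x * b"
  using selberg_weight_cases[OF assms(1)] assms(2) by (metis mult_zero_left)

definition shift_exponent ::
    "nat \<Rightarrow> nat \<Rightarrow> real \<Rightarrow> (nat \<Rightarrow> nat \<Rightarrow> real) \<Rightarrow> nat \<Rightarrow> nat \<Rightarrow> real" where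
  "shift_exponent k l s e = e(k := (e k)(l := e k l + s))"

lemma selberg_weight_shift_exponent:
  assumes "(k, l) \<in> node_pairs n"
  shows "selberg_weight n (shift_exponent k l s e) x
    = \<bar>node n x k - node n x l\<bar> powr s * selberg_weight n e x"
proof -
  have "power_product n (shift_exponent k l s e) (node_pairs n - {(k, l)}) x
      = power_product n e (node_pairs n - {(k, l)}) x"
    unfolding power_product_def shift_exponent_def by (intro prod.cong) (auto split: if_splits)
  then show ?thesis
    using assms by (simp add: power_product_remove[of _ k l] shift_exponent_def powr_add)
qed

text \<open>For \<open>\<phi> z w = ln \<bar>z - w\<bar>\<close> and without its terms \<open>i = j\<close>, this is the logarithm of the weight.
  Exponents \<open>e i i = 1\<close> do not enter the weight and make the terms \<open>i = j\<close> account for the Jacobian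
  determinant of a substitution.\<close>

definition exponent_sum ::
    "nat \<Rightarrow> (nat \<Rightarrow> nat \<Rightarrow> real) \<Rightarrow> (real \<Rightarrow> real \<Rightarrow> real) \<Rightarrow> (nat \<Rightarrow> real) \<Rightarrow> real" where
  "exponent_sum n e \<phi> x = (\<Sum>i<n. \<Sum>j<n + 2. e i j * \<phi> (node n x i) (node n x j))"

lemma exponent_sum_diff_mult:
  "exponent_sum n e (\<lambda>z w. \<phi> z w - c * \<psi> z w) x
    = exponent_sum n e \<phi> x - c * exponent_sum n e \<psi> x"
  by (simp only: exponent_sum_def right_diff_distrib sum_subtractf sum_distrib_left
      mult.left_commute)

lemma abs_exponent_sum_le:
  assumes "\<And>i j. i < n \<Longrightarrow> j < n + 2 \<Longrightarrow> \<bar>\<phi> (node n x i) (node n x j)\<bar> \<le> q i j"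
  shows "\<bar>exponent_sum n e \<phi> x\<bar> \<le> (\<Sum>i<n. \<Sum>j<n + 2. \<bar>e i j\<bar> * q i j)"
  unfolding exponent_sum_def using assms
  by (intro sum_mono order_trans[OF sum_abs]) (simp add: abs_mult mult_left_mono)

lemma measurable_exponent_sum:
  assumes "continuous_on ({0..1} \<times> {0..1}) (\<lambda>(z, w). \<phi> z w)"
  shows "exponent_sum n e \<phi> \<in> borel_measurable (jacobi_measure n)"
proof -
  let ?Q = "restrict_space borel ({0..1} \<times> {0..1}) :: (real \<times> real) measure"
  have "(\<lambda>(z, w). \<phi> z w) \<in> borel_measurable ?Q"
    using assms by (rule borel_measurable_continuous_on_restrict)
  moreover have "(\<lambda>x. (node n x i, node n x j)) \<in> jacobi_measure n \<rightarrow>\<^sub>M ?Q" for i j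
    using node_in_unit by (intro measurable_restrict_space2) (auto simp flip: borel_prod)
  ultimately have "(\<lambda>x. (\<lambda>(z, w). \<phi> z w) (node n x i, node n x j))
      \<in> borel_measurable (jacobi_measure n)" for i j
    by (rule measurable_compose[rotated])
  then show ?thesis
    unfolding exponent_sum_def[abs_def] by simp
qed

lemma continuous_on_unit_square_bounded:
  fixes \<phi> :: "real \<Rightarrow> real \<Rightarrow> real"
  assumes "continuous_on ({0..1} \<times> {0..1}) (\<lambda>(z, w). \<phi> z w)"
  obtains K where "\<And>z w. z \<in> {0..1} \<Longrightarrow> w \<in> {0..1} \<Longrightarrow> \<bar>\<phi> z w\<bar> \<le> K"
proof -
  have "compact ((\<lambda>(z, w). \<phi> z w) ` ({0..1} \<times> {0..1}))"
    using assms by (intro compact_continuous_image compact_Times) auto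
  from compact_imp_bounded[OF this]
  obtain K where "\<forall>p\<in>{0..1} \<times> {0..1}. norm ((\<lambda>(z, w). \<phi> z w) p) \<le> K"
    unfolding bounded_iff by auto
  then show thesis
    by (intro that[of K]) auto
qed

lemma bounded_exponent_sum:
  assumes "continuous_on ({0..1} \<times> {0..1}) (\<lambda>(z, w). \<phi> z w)"
  obtains B where "\<And>x. x \<in> space (jacobi_measure n) \<Longrightarrow> \<bar>exponent_sum n e \<phi> x\<bar> \<le> B"
proof -
  obtain K where "\<And>z w. z \<in> {0..1} \<Longrightarrow> w \<in> {0..1} \<Longrightarrow> \<bar>\<phi> z w\<bar> \<le> K"
    using continuous_on_unit_square_bounded[OF assms] by blast
  then show thesis
    by (intro that[of "\<Sum>i<n. \<Sum>j<n + 2. \<bar>e i j\<bar> * K"] abs_exponent_sum_le)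
      (blast intro: node_in_unit)
qed

lemma integrable_mult_bounded:
  fixes f g :: "'a \<Rightarrow> real"
  assumes "integrable M f" "g \<in> borel_measurable M"
    and bound: "\<And>x. x \<in> space M \<Longrightarrow> \<bar>g x\<bar> \<le> B"
  shows "integrable M (\<lambda>x. f x * g x)"
proof (rule Bochner_Integration.integrable_bound)
  show "integrable M (\<lambda>x. f x * B)"
    using assms(1) by (rule integrable_mult_left)
  show "AE x in M. norm (f x * g x) \<le> norm (f x * B)"
    using bound by (intro AE_I2) (force simp: abs_mult intro: mult_left_mono)
qed (use assms(1,2) in auto)

lemma
  assumes integrable: "integrable (jacobi_measure n) f"
    and continuous: "continuous_on ({0..1} \<times> {0..1}) (\<lambda>(z, w). \<phi> z w)"
  shows integrable_exponent_sum:
      "integrable (jacobi_measure n) (\<lambda>x. f x * exponent_sum n e \<phi> x)"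
    and integrable_exp_exponent_sum:
      "integrable (jacobi_measure n) (\<lambda>x. f x * exp (exponent_sum n e \<phi> x))"
proof -
  note [measurable] = measurable_exponent_sum[OF continuous]
  obtain B where bound: "\<And>x. x \<in> space (jacobi_measure n) \<Longrightarrow> \<bar>exponent_sum n e \<phi> x\<bar> \<le> B"
    using bounded_exponent_sum[OF continuous] by blast
  show "integrable (jacobi_measure n) (\<lambda>x. f x * exponent_sum n e \<phi> x)"
    by (rule integrable_mult_bounded[OF integrable _ bound]) simp
  show "integrable (jacobi_measure n) (\<lambda>x. f x * exp (exponent_sum n e \<phi> x))"
    using bound
    by (intro integrable_mult_bounded[OF integrable, where B = "exp B"]) (auto simp: abs_le_iff)
qed

subsection \<open>Vanishing of the weighted divergence\<close>

locale tangential_field =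
  fixes v :: "real \<Rightarrow> real" and D :: "real \<Rightarrow> real \<Rightarrow> real"
  assumes vanishes: "v 0 = 0" "v 1 = 0"
    and divided_difference: "z \<in> {0..1} \<Longrightarrow> w \<in> {0..1} \<Longrightarrow> v z - v w = (z - w) * D z w"
    and has_deriv: "z \<in> {0..1} \<Longrightarrow> (v has_real_derivative D z z) (at z)"
    and continuous: "continuous_on ({0..1} \<times> {0..1}) (\<lambda>(z, w). D z w)"
begin

definition log_factor :: "real \<Rightarrow> real \<Rightarrow> real \<Rightarrow> real" where
  "log_factor t z w = ln (1 + t * D z w)"

context
  fixes t :: real
  assumes small: "\<And>z w. z \<in> {0..1} \<Longrightarrow> w \<in> {0..1} \<Longrightarrow> \<bar>t * D z w\<bar> \<le> 1 / 2"
begin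

lemma factor_pos: "z \<in> {0..1} \<Longrightarrow> w \<in> {0..1} \<Longrightarrow> 0 < 1 + t * D z w"
  using small[of z w] by linarith

lemma unit_reparametrization_flow:
  "unit_reparametrization (\<lambda>z. z + t * v z) (\<lambda>z. 1 + t * D z z)"
proof
  have "continuous_on {0..1} (\<lambda>z. (\<lambda>(z, w). D z w) (z, z))"
    by (rule continuous_on_compose2[OF continuous]) (auto intro!: continuous_intros)
  then show "continuous_on {0..1} (\<lambda>z. 1 + t * D z z)"
    by (auto intro!: continuous_intros)
qed (auto intro!: derivative_eq_intros has_deriv less_imp_le[OF factor_pos] simp: vanishes)

lemma continuous_log_factor: "continuous_on ({0..1} \<times> {0..1}) (\<lambda>(z, w). log_factor t z w)"
  unfolding log_factor_def case_prod_beta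
  using continuous factor_pos by (intro continuous_intros) (force simp: case_prod_beta)+

lemma powr_node_distance_flow:
  fixes x :: "nat \<Rightarrow> real" and s :: real
  assumes x_space: "x \<in> space (jacobi_measure n)"
  defines "y \<equiv> compose {..<n} (\<lambda>z. z + t * v z) x"
  shows "\<bar>node n y i - node n y j\<bar> powr s
    = \<bar>node n x i - node n x j\<bar> powr s * (1 + t * D (node n x i) (node n x j)) powr s"
proof -
  have node_y: "node n y k = node n x k + t * v (node n x k)" for k
    by (simp add: y_def node_def compose_def vanishes)
  have "node n y i - node n y j
      = (node n x i - node n x j) + t * (v (node n x i) - v (node n x j))"
    unfolding node_y by (simp add: algebra_simps)
  also have "\<dots> = (node n x i - node n x j) * (1 + t * D (node n x i) (node n x j))"
    by (simp only: divided_difference[OF node_in_unit[OF x_space] node_in_unit[OF x_space]])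
      (simp add: algebra_simps)
  finally show ?thesis
    using factor_pos[OF node_in_unit[OF x_space] node_in_unit[OF x_space], of i j]
    by (simp add: abs_mult powr_mult)
qed

lemma selberg_weight_flow:
  assumes x_space: "x \<in> space (jacobi_measure n)" and diagonal: "\<And>i. i < n \<Longrightarrow> e i i = 1"
  shows "(\<Prod>i<n. 1 + t * D (x i) (x i)) * selberg_weight n e (compose {..<n} (\<lambda>z. z + t * v z) x)
    = selberg_weight n e x * exp (exponent_sum n e (log_factor t) x)"
proof -
  let ?f = "\<lambda>i j. 1 + t * D (node n x i) (node n x j)"
  have f_pos: "0 < ?f i j" for i j
    using node_in_unit[OF x_space] factor_pos by blast
  have not_diagonal: "(i, i) \<notin> node_pairs n" for i
    by (simp add: node_pairs_def)
  have all_pairs: "{..<n} \<times> {..<n + 2} = (\<lambda>i. (i, i)) ` {..<n} \<union> node_pairs n"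
    by (auto simp: node_pairs_def)
  have "exp (exponent_sum n e (log_factor t) x) = (\<Prod>i<n. \<Prod>j<n + 2. ?f i j powr e i j)"
    using f_pos by (simp add: exponent_sum_def log_factor_def exp_sum powr_def
        less_imp_neq[THEN not_sym] del: sum.lessThan_Suc prod.lessThan_Suc)
  also have "\<dots> = (\<Prod>(i, j)\<in>(\<lambda>i. (i, i)) ` {..<n} \<union> node_pairs n. ?f i j powr e i j)"
    by (simp only: prod.cartesian_product all_pairs)
  also have "\<dots> = (\<Prod>i<n. ?f i i) * (\<Prod>(i, j)\<in>node_pairs n. ?f i j powr e i j)"
    using f_pos diagonal
    by (subst prod.union_disjoint) (auto simp: not_diagonal prod.reindex inj_on_def less_imp_le)
  finally have "exp (exponent_sum n e (log_factor t) x)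
      = (\<Prod>i<n. 1 + t * D (x i) (x i)) * (\<Prod>(i, j)\<in>node_pairs n. ?f i j powr e i j)"
    by (simp add: node_def)
  then show ?thesis
    by (simp add: power_product_def powr_node_distance_flow[OF x_space] prod.distrib case_prod_beta)
qed

lemma integral_selberg_weight_flow:
  assumes "\<And>i. i < n \<Longrightarrow> e i i = 1"
  shows "(\<integral>x. selberg_weight n e x * exp (exponent_sum n e (log_factor t) x) \<partial>jacobi_measure n)
    = (\<integral>x. selberg_weight n e x \<partial>jacobi_measure n)"
proof -
  interpret flow: unit_reparametrization "\<lambda>z. z + t * v z" "\<lambda>z. 1 + t * D z z"
    by (rule unit_reparametrization_flow)
  have "(\<integral>x. selberg_weight n e x * exp (exponent_sum n e (log_factor t) x) \<partial>jacobi_measure n)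
      = (\<integral>x. (\<Prod>i<n. 1 + t * D (x i) (x i)) *
           selberg_weight n e (compose {..<n} (\<lambda>z. z + t * v z) x) \<partial>jacobi_measure n)"
    using selberg_weight_flow assms by (intro Bochner_Integration.integral_cong) auto
  also have "\<dots> = (\<integral>x. selberg_weight n e x \<partial>jacobi_measure n)"
    using measurable_power_product unfolding jacobi_measure_eq_PiM
    by (intro flow.integral_PiM_compose) auto
  finally show ?thesis .
qed

lemma log_factor_approx:
  assumes D_bound: "\<And>z w. z \<in> {0..1} \<Longrightarrow> w \<in> {0..1} \<Longrightarrow> \<bar>D z w\<bar> \<le> K"
    and "z \<in> {0..1}" "w \<in> {0..1}"
  shows "\<bar>log_factor t z w - t * D z w\<bar> \<le> t\<^sup>2 * (2 * K\<^sup>2)"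
proof -
  have "\<bar>log_factor t z w - t * D z w\<bar> \<le> 2 * (t * D z w)\<^sup>2"
    unfolding log_factor_def by (rule abs_ln_one_plus_x_minus_x_bound) (rule small[OF assms(2,3)])
  also have "\<dots> = t\<^sup>2 * (2 * (D z w)\<^sup>2)"
    by (simp add: power_mult_distrib)
  also have "\<dots> \<le> t\<^sup>2 * (2 * K\<^sup>2)"
    using D_bound[OF assms(2,3)] by (intro mult_left_mono) (auto simp: abs_le_square_iff[symmetric])
  finally show ?thesis .
qed

lemma log_factor_sum_ge:
  assumes D_bound: "\<And>z w. z \<in> {0..1} \<Longrightarrow> w \<in> {0..1} \<Longrightarrow> \<bar>D z w\<bar> \<le> K"
    and x_space: "x \<in> space (jacobi_measure n)"
  shows "t * exponent_sum n e D x - t\<^sup>2 * (\<Sum>i<n. \<Sum>j<n + 2. \<bar>e i j\<bar> * (2 * K\<^sup>2))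
    \<le> exponent_sum n e (log_factor t) x"
proof -
  have "\<bar>exponent_sum n e (log_factor t) x - t * exponent_sum n e D x\<bar>
      \<le> (\<Sum>i<n. \<Sum>j<n + 2. \<bar>e i j\<bar> * (t\<^sup>2 * (2 * K\<^sup>2)))"
    unfolding exponent_sum_diff_mult[symmetric]
    by (intro abs_exponent_sum_le log_factor_approx D_bound node_in_unit[OF x_space])
  also have "\<dots> = t\<^sup>2 * (\<Sum>i<n. \<Sum>j<n + 2. \<bar>e i j\<bar> * (2 * K\<^sup>2))"
    by (simp only: sum_distrib_left mult.left_commute)
  finally show ?thesis by linarith
qed

lemma integral_log_factor_sum_nonpos:
  assumes integrable: "integrable (jacobi_measure n) (selberg_weight n e)"
    and diagonal: "\<And>i. i < n \<Longrightarrow> e i i = 1"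
  shows "(\<integral>x. selberg_weight n e x * exponent_sum n e (log_factor t) x \<partial>jacobi_measure n) \<le> 0"
proof -
  let ?M = "jacobi_measure n" and ?W = "selberg_weight n e"
    and ?S = "exponent_sum n e (log_factor t)"
  note integrable_S = integrable_exponent_sum[OF integrable continuous_log_factor]
    and integrable_exp_S = integrable_exp_exponent_sum[OF integrable continuous_log_factor]
  have "(\<integral>x. ?W x * ?S x \<partial>?M) \<le> (\<integral>x. ?W x * exp (?S x) - ?W x \<partial>?M)"
  proof (intro integral_mono integrable_S Bochner_Integration.integrable_diff integrable_exp_S
      integrable)
    fix x
    have "?W x * ?S x \<le> ?W x * (exp (?S x) - 1)"
      using exp_ge_add_one_self[of "?S x"] by (intro mult_left_mono power_product_nonneg) linarith
    then show "?W x * ?S x \<le> ?W x * exp (?S x) - ?W x"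
      by (simp add: right_diff_distrib)
  qed
  also have "\<dots> = 0"
    by (simp add: integrable integrable_exp_S integral_selberg_weight_flow[OF diagonal])
  finally show ?thesis .
qed

lemma integral_divergence_le:
  assumes integrable: "integrable (jacobi_measure n) (selberg_weight n e)"
    and diagonal: "\<And>i. i < n \<Longrightarrow> e i i = 1"
    and D_bound: "\<And>z w. z \<in> {0..1} \<Longrightarrow> w \<in> {0..1} \<Longrightarrow> \<bar>D z w\<bar> \<le> K"
  shows "t * (\<integral>x. selberg_weight n e x * exponent_sum n e D x \<partial>jacobi_measure n)
    \<le> t\<^sup>2 * ((\<Sum>i<n. \<Sum>j<n + 2. \<bar>e i j\<bar> * (2 * K\<^sup>2)) *
        (\<integral>x. selberg_weight n e x \<partial>jacobi_measure n))"
proof -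
  let ?M = "jacobi_measure n" and ?W = "selberg_weight n e"
    and ?S = "exponent_sum n e (log_factor t)" and ?E = "exponent_sum n e D"
  let ?C = "\<Sum>i<n. \<Sum>j<n + 2. \<bar>e i j\<bar> * (2 * K\<^sup>2)"
  note integrable_S = integrable_exponent_sum[OF integrable continuous_log_factor]
    and integrable_E = integrable_exponent_sum[OF integrable continuous]
  have "t * (\<integral>x. ?W x * ?E x \<partial>?M) - t\<^sup>2 * (?C * (\<integral>x. ?W x \<partial>?M))
      = (\<integral>x. t * (?W x * ?E x) - t\<^sup>2 * ?C * ?W x \<partial>?M)"
    by (subst Bochner_Integration.integral_diff)
      (simp_all only: integrable_E integrable integrable_mult_right integral_mult_right_zero
        mult.assoc)
  also have "\<dots> \<le> (\<integral>x. ?W x * ?S x \<partial>?M)"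
  proof (intro integral_mono integrable_S Bochner_Integration.integrable_diff integrable_mult_right
      integrable_E integrable)
    fix x assume "x \<in> space ?M"
    with D_bound have "?W x * (t * ?E x - t\<^sup>2 * ?C) \<le> ?W x * ?S x"
      by (intro mult_left_mono power_product_nonneg log_factor_sum_ge)
    then show "t * (?W x * ?E x) - t\<^sup>2 * ?C * ?W x \<le> ?W x * ?S x"
      by (simp only: right_diff_distrib mult_ac)
  qed
  also have "\<dots> \<le> 0"
    using integrable diagonal by (rule integral_log_factor_sum_nonpos)
  finally show ?thesis by simp
qed

end

theorem integral_divergence_eq_0:
  assumes integrable: "integrable (jacobi_measure n) (selberg_weight n e)"
    and diagonal: "\<And>i. i < n \<Longrightarrow> e i i = 1"
  shows "(\<integral>x. selberg_weight n e x * exponent_sum n e D x \<partial>jacobi_measure n) = 0" (is "?I = 0")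
proof -
  obtain K where D_bound: "\<And>z w. z \<in> {0..1} \<Longrightarrow> w \<in> {0..1} \<Longrightarrow> \<bar>D z w\<bar> \<le> K"
    using continuous_on_unit_square_bounded[OF continuous] by blast
  define C where "C = (\<Sum>i<n. \<Sum>j<n + 2. \<bar>e i j\<bar> * (2 * K\<^sup>2)) *
    (\<integral>x. selberg_weight n e x \<partial>jacobi_measure n)"
  have quadratic_bound: "t * ?I \<le> t\<^sup>2 * C" if "\<bar>t\<bar> * K \<le> 1 / 2" for t
    unfolding C_def
  proof (rule integral_divergence_le[OF _ integrable diagonal D_bound])
    fix z w :: real assume "z \<in> {0..1}" "w \<in> {0..1}"
    then have "\<bar>t\<bar> * \<bar>D z w\<bar> \<le> \<bar>t\<bar> * K"
      using D_bound by (intro mult_left_mono) auto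
    with that show "\<bar>t * D z w\<bar> \<le> 1 / 2" by (simp add: abs_mult)
  qed
  have linear_bound: "\<bar>?I\<bar> \<le> t * C" if "0 < t" "t * K < 1 / 2" for t
  proof -
    have "t * ?I \<le> t * (t * C)" "t * (- ?I) \<le> t * (t * C)"
      using quadratic_bound[of t] quadratic_bound[of "- t"] that
      by (simp_all add: power2_eq_square mult.assoc)
    then have "?I \<le> t * C" "- ?I \<le> t * C"
      using that(1) by (simp_all only: mult_le_cancel_left_pos)
    then show ?thesis by simp
  qed
  have "\<forall>\<^sub>F t in at_right 0. t * K < 1 / 2"
    by (rule order_tendstoD(2)[where y = "0 * K"]) (auto intro!: tendsto_eq_intros)
  with eventually_at_right_less[of "0 :: real"] have "\<forall>\<^sub>F t in at_right 0. \<bar>?I\<bar> \<le> t * C"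
    by eventually_elim (rule linear_bound)
  moreover have "((\<lambda>t. t * C) \<longlongrightarrow> 0) (at_right 0)"
    by (auto intro!: tendsto_eq_intros)
  ultimately have "\<bar>?I\<bar> \<le> 0"
    by (intro tendsto_lowerbound) auto
  then show ?thesis by simp
qed

end

subsection \<open>Fields that do not vanish at the origin\<close>

text \<open>Pointwise limits of the divided differences of fields tending to \<open>1 - z\<close> and \<open>1 / z - 1\<close> on
  \<open>{0<..1}\<close> but vanishing at 0. Hence the value at \<open>w = 0\<close> is the limit field divided by \<open>z\<close>.\<close>

definition one_minus_quotient :: "real \<Rightarrow> real \<Rightarrow> real" where
  "one_minus_quotient z w = (if w = 0 then 1 / z - 1 else - 1)"

definition inverse_minus_one_quotient :: "real \<Rightarrow> real \<Rightarrow> real" where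
  "inverse_minus_one_quotient z w = (if w = 0 then 1 / z\<^sup>2 - 1 / z else - (1 / (z * w)))"

lemma node_in_unit_pos:
  assumes "x \<in> space (jacobi_measure n)" "\<And>i. i < n \<Longrightarrow> 0 < x i" "i < n"
  shows "node n x i \<in> {0<..1}"
  using node_in_unit[OF assms(1), of i] assms(2,3) by (auto simp: node_def)

lemma selberg_weight_exponent_sum_tendsto:
  assumes x_space: "x \<in> space (jacobi_measure n)"
    and tendsto: "\<And>z w. z \<in> {0<..1} \<Longrightarrow> w \<in> {0..1} \<Longrightarrow> (\<lambda>k. \<phi> k z w) \<longlonglongrightarrow> \<psi> z w"
  shows "(\<lambda>k. selberg_weight n e x * exponent_sum n e' (\<phi> k) x)
    \<longlonglongrightarrow> selberg_weight n e x * exponent_sum n e' \<psi> x"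
  using x_space
proof (cases rule: selberg_weight_cases[where e = e])
  case positive
  then show ?thesis
    unfolding exponent_sum_def
    by (intro tendsto_mult tendsto_sum tendsto_const tendsto
        node_in_unit_pos[OF x_space] node_in_unit[OF x_space]) auto
qed simp

lemma abs_selberg_weight_exponent_sum_le:
  assumes x_space: "x \<in> space (jacobi_measure n)"
    and bound: "\<And>z w. z \<in> {0<..1} \<Longrightarrow> w \<in> {0..1} \<Longrightarrow> \<bar>\<phi> z w\<bar> \<le> \<psi> z w"
  shows "\<bar>selberg_weight n e x * exponent_sum n e' \<phi> x\<bar>
    \<le> selberg_weight n e x * exponent_sum n (\<lambda>i j. \<bar>e' i j\<bar>) \<psi> x"
  using x_space
proof (cases rule: selberg_weight_cases[where e = e])
  case positive
  then have "\<bar>exponent_sum n e' \<phi> x\<bar> \<le> exponent_sum n (\<lambda>i j. \<bar>e' i j\<bar>) \<psi> x"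
    unfolding exponent_sum_def[of n "\<lambda>i j. \<bar>e' i j\<bar>"]
    by (intro abs_exponent_sum_le bound node_in_unit_pos[OF x_space] node_in_unit[OF x_space]) auto
  then show ?thesis
    by (simp add: abs_mult power_product_nonneg mult_left_mono)
qed simp

lemma integrable_mult_exponent_sum_add:
  fixes f :: "(nat \<Rightarrow> real) \<Rightarrow> real"
  assumes "integrable M f" and "\<And>i. i < n \<Longrightarrow> integrable M (\<lambda>x. f x * q (x i))"
  shows "integrable M (\<lambda>x. f x * exponent_sum n e (\<lambda>z w. q z + q w) x)"
proof -
  have integrable_node: "integrable M (\<lambda>x. f x * q (node n x j))" for j
    using assms by (cases "j < n") (simp_all add: node_def)
  have "f x * exponent_sum n e (\<lambda>z w. q z + q w) x
      = (\<Sum>i<n. \<Sum>j<n + 2. e i j * (f x * q (node n x i) + f x * q (node n x j)))" for x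
    by (simp only: exponent_sum_def sum_distrib_left distrib_left mult.left_commute)
  then show ?thesis
    by (simp only:) (intro Bochner_Integration.integrable_sum Bochner_Integration.integrable_add
        integrable_mult_right integrable_node)
qed

lemma integral_divergence_limit_eq_0:
  fixes v :: "nat \<Rightarrow> real \<Rightarrow> real" and D :: "nat \<Rightarrow> real \<Rightarrow> real \<Rightarrow> real"
  assumes field: "\<And>k. tangential_field (v k) (D k)"
    and diagonal: "\<And>i. i < n \<Longrightarrow> e i i = 1"
    and integrable: "integrable (jacobi_measure n) (selberg_weight n e)"
    and integrable_q:
      "\<And>i. i < n \<Longrightarrow> integrable (jacobi_measure n) (\<lambda>x. selberg_weight n e x * q (x i))"
    and bound: "\<And>k z w. z \<in> {0<..1} \<Longrightarrow> w \<in> {0..1} \<Longrightarrow> \<bar>D k z w\<bar> \<le> q z + q w"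
    and tendsto: "\<And>z w. z \<in> {0<..1} \<Longrightarrow> w \<in> {0..1} \<Longrightarrow> (\<lambda>k. D k z w) \<longlonglongrightarrow> L z w"
  shows "(\<integral>x. selberg_weight n e x * exponent_sum n e L x \<partial>jacobi_measure n) = 0"
proof -
  let ?M = "jacobi_measure n" and ?W = "selberg_weight n e"
  have [measurable]: "exponent_sum n e (D k) \<in> borel_measurable ?M" for k
    by (rule measurable_exponent_sum[OF tangential_field.continuous[OF field]])
  have "(\<lambda>k. \<integral>x. ?W x * exponent_sum n e (D k) x \<partial>?M) \<longlonglongrightarrow> (\<integral>x. ?W x * exponent_sum n e L x \<partial>?M)"
  proof (rule integral_dominated_convergence)
    show "(\<lambda>x. ?W x * exponent_sum n e L x) \<in> borel_measurable ?M"
      by (rule borel_measurable_LIMSEQ_real[OF selberg_weight_exponent_sum_tendsto[OF _ tendsto]])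
        measurable
    show "integrable ?M (\<lambda>x. ?W x * exponent_sum n (\<lambda>i j. \<bar>e i j\<bar>) (\<lambda>z w. q z + q w) x)"
      using integrable integrable_q by (rule integrable_mult_exponent_sum_add)
    show "AE x in ?M. (\<lambda>k. ?W x * exponent_sum n e (D k) x) \<longlonglongrightarrow> ?W x * exponent_sum n e L x"
      by (intro AE_I2 selberg_weight_exponent_sum_tendsto tendsto)
    show "AE x in ?M. norm (?W x * exponent_sum n e (D k) x)
        \<le> ?W x * exponent_sum n (\<lambda>i j. \<bar>e i j\<bar>) (\<lambda>z w. q z + q w) x" for k
      unfolding real_norm_def by (intro AE_I2 abs_selberg_weight_exponent_sum_le bound)
  qed measurable
  moreover have "(\<integral>x. ?W x * exponent_sum n e (D k) x \<partial>?M) = 0" for k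
    by (rule tangential_field.integral_divergence_eq_0[OF field integrable diagonal])
  ultimately show ?thesis
    by (simp add: LIMSEQ_const_iff)
qed

lemma tangential_field_shift:
  assumes "0 < \<epsilon>"
  shows "tangential_field (\<lambda>z. z * (1 - z) / (z + \<epsilon>))
    (\<lambda>z w. \<epsilon> * (1 + \<epsilon>) / ((z + \<epsilon>) * (w + \<epsilon>)) - 1)"
proof
  fix z w :: real
  assume "z \<in> {0..1}" "w \<in> {0..1}"
  then have "0 < z + \<epsilon>" "0 < w + \<epsilon>"
    using assms by auto
  then show "z * (1 - z) / (z + \<epsilon>) - w * (1 - w) / (w + \<epsilon>)
      = (z - w) * (\<epsilon> * (1 + \<epsilon>) / ((z + \<epsilon>) * (w + \<epsilon>)) - 1)"
    by (simp add: divide_simps) algebra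
next
  fix z :: real
  assume "z \<in> {0..1}"
  then have "0 < z + \<epsilon>"
    using assms by auto
  then show "((\<lambda>z. z * (1 - z) / (z + \<epsilon>)) has_real_derivative
      \<epsilon> * (1 + \<epsilon>) / ((z + \<epsilon>) * (z + \<epsilon>)) - 1) (at z)"
    by (auto intro!: derivative_eq_intros simp: divide_simps) algebra
qed (use assms in \<open>auto simp: case_prod_beta intro!: continuous_intros\<close>)

lemma tangential_field_square_shift:
  assumes "0 < \<epsilon>"
  shows "tangential_field (\<lambda>z. z * (1 - z) / (z\<^sup>2 + \<epsilon>))
    (\<lambda>z w. (\<epsilon> * (1 - z - w) - z * w) / ((z\<^sup>2 + \<epsilon>) * (w\<^sup>2 + \<epsilon>)))"
proof
  have denominator_pos: "0 < z\<^sup>2 + \<epsilon>" for z :: real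
    using assms by (intro add_nonneg_pos) auto
  fix z w :: real
  show "z * (1 - z) / (z\<^sup>2 + \<epsilon>) - w * (1 - w) / (w\<^sup>2 + \<epsilon>)
      = (z - w) * ((\<epsilon> * (1 - z - w) - z * w) / ((z\<^sup>2 + \<epsilon>) * (w\<^sup>2 + \<epsilon>)))"
    using denominator_pos[of z] denominator_pos[of w] by (simp add: divide_simps) algebra
  show "((\<lambda>z. z * (1 - z) / (z\<^sup>2 + \<epsilon>)) has_real_derivative
      (\<epsilon> * (1 - z - z) - z * z) / ((z\<^sup>2 + \<epsilon>) * (z\<^sup>2 + \<epsilon>))) (at z)"
    using denominator_pos[of z]
    by (auto intro!: derivative_eq_intros simp: divide_simps) algebra
  show "continuous_on ({0..1} \<times> {0..1})
      (\<lambda>(z, w). (\<epsilon> * (1 - z - w) - z * w) / ((z\<^sup>2 + \<epsilon>) * (w\<^sup>2 + \<epsilon>)))"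
    using denominator_pos
    by (auto simp: case_prod_beta less_imp_neq[THEN not_sym] intro!: continuous_intros)
qed (use assms in auto)

lemma abs_shift_quotient_le:
  fixes z w \<epsilon> :: real
  assumes "z \<in> {0<..1}" "w \<in> {0..1}" "0 < \<epsilon>" "\<epsilon> \<le> 1"
  shows "\<bar>\<epsilon> * (1 + \<epsilon>) / ((z + \<epsilon>) * (w + \<epsilon>)) - 1\<bar> \<le> 2 / z"
proof -
  have "\<epsilon> * (1 + \<epsilon>) / ((z + \<epsilon>) * (w + \<epsilon>)) = (1 + \<epsilon>) / (z + \<epsilon>) * (\<epsilon> / (w + \<epsilon>))"
    by simp
  also have "\<dots> \<le> 2 / z * 1"
    using assms by (intro mult_mono frac_le) auto
  finally have "\<epsilon> * (1 + \<epsilon>) / ((z + \<epsilon>) * (w + \<epsilon>)) \<le> 2 / z" by simp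
  moreover have "0 \<le> \<epsilon> * (1 + \<epsilon>) / ((z + \<epsilon>) * (w + \<epsilon>))" "1 \<le> 2 / z"
    using assms by simp_all
  ultimately show ?thesis by linarith
qed

text \<open>The bound also holds for \<open>w = 0\<close>, where the last summand is 0.\<close>

lemma abs_square_shift_quotient_le:
  fixes z w \<epsilon> :: real
  assumes "z \<in> {0<..1}" "w \<in> {0..1}" "0 < \<epsilon>"
  shows "\<bar>(\<epsilon> * (1 - z - w) - z * w) / ((z\<^sup>2 + \<epsilon>) * (w\<^sup>2 + \<epsilon>))\<bar> \<le> 2 / z\<^sup>2 + 2 / w\<^sup>2"
proof -
  let ?q = "(z\<^sup>2 + \<epsilon>) * (w\<^sup>2 + \<epsilon>)"
  have q_ge: "0 < ?q" "z\<^sup>2 * \<epsilon> \<le> ?q" "z\<^sup>2 * w\<^sup>2 \<le> ?q"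
    using assms by (auto intro!: mult_pos_pos mult_mono add_nonneg_pos)
  have "\<bar>\<epsilon> * (1 - z - w)\<bar> \<le> \<epsilon>"
    using assms by (auto simp: abs_mult intro!: mult_left_le)
  then have "\<bar>\<epsilon> * (1 - z - w)\<bar> / ?q \<le> \<epsilon> / (z\<^sup>2 * \<epsilon>)"
    using assms q_ge by (intro frac_le) auto
  then have "\<bar>\<epsilon> * (1 - z - w)\<bar> / ?q \<le> 1 / z\<^sup>2"
    using assms by simp
  moreover have "z * w / ?q \<le> 1 / z\<^sup>2 + 1 / w\<^sup>2"
  proof (cases "w = 0")
    case False
    then have "z * w / ?q \<le> z * w / (z\<^sup>2 * w\<^sup>2)"
      using assms q_ge by (intro divide_left_mono) auto
    also have "\<dots> = (1 / z) * (1 / w)"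
      using assms False by (simp add: power2_eq_square)
    also have "\<dots> \<le> 2 * (1 / z) * (1 / w)"
      using assms by (simp add: divide_right_mono)
    also have "\<dots> \<le> (1 / z)\<^sup>2 + (1 / w)\<^sup>2"
      by (rule sum_squares_bound)
    finally show ?thesis by (simp add: power_divide)
  qed simp
  moreover have "\<bar>(\<epsilon> * (1 - z - w) - z * w) / ?q\<bar> \<le> \<bar>\<epsilon> * (1 - z - w)\<bar> / ?q + z * w / ?q"
    using abs_triangle_ineq4[of "\<epsilon> * (1 - z - w)" "z * w"] assms q_ge
    by (simp add: abs_divide divide_right_mono flip: add_divide_distrib)
  moreover have "1 / w\<^sup>2 \<le> 2 / w\<^sup>2"
    by (intro divide_right_mono) auto
  ultimately show ?thesis by linarith
qed

lemma shift_quotient_tendsto: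
  fixes \<epsilon> :: "nat \<Rightarrow> real"
  assumes "z \<in> {0<..1}" "w \<in> {0..1}" and \<epsilon>_pos: "\<And>k. 0 < \<epsilon> k" and \<epsilon>_tendsto: "\<epsilon> \<longlonglongrightarrow> 0"
  shows "(\<lambda>k. \<epsilon> k * (1 + \<epsilon> k) / ((z + \<epsilon> k) * (w + \<epsilon> k)) - 1) \<longlonglongrightarrow> one_minus_quotient z w"
proof (cases "w = 0")
  case True
  have "(\<lambda>k. (1 + \<epsilon> k) / (z + \<epsilon> k) - 1) \<longlonglongrightarrow> 1 / z - 1"
    using assms(1) by (auto intro!: tendsto_eq_intros \<epsilon>_tendsto)
  with True \<epsilon>_pos show ?thesis
    by (simp add: one_minus_quotient_def less_imp_neq[THEN not_sym])
next
  case False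
  with assms(1,2) show ?thesis
    by (auto intro!: tendsto_eq_intros \<epsilon>_tendsto simp: one_minus_quotient_def)
qed

lemma square_shift_quotient_tendsto:
  fixes \<epsilon> :: "nat \<Rightarrow> real"
  assumes "z \<in> {0<..1}" "w \<in> {0..1}" and \<epsilon>_pos: "\<And>k. 0 < \<epsilon> k" and \<epsilon>_tendsto: "\<epsilon> \<longlonglongrightarrow> 0"
  shows "(\<lambda>k. (\<epsilon> k * (1 - z - w) - z * w) / ((z\<^sup>2 + \<epsilon> k) * (w\<^sup>2 + \<epsilon> k)))
    \<longlonglongrightarrow> inverse_minus_one_quotient z w"
proof (cases "w = 0")
  case True
  have "(\<lambda>k. (1 - z) / (z\<^sup>2 + \<epsilon> k)) \<longlonglongrightarrow> 1 / z\<^sup>2 - 1 / z"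
    using assms(1) by (auto intro!: tendsto_eq_intros \<epsilon>_tendsto simp: field_simps power2_eq_square)
  with True \<epsilon>_pos show ?thesis
    by (simp add: inverse_minus_one_quotient_def less_imp_neq[THEN not_sym])
next
  case False
  with assms(1,2) show ?thesis
    by (auto intro!: tendsto_eq_intros \<epsilon>_tendsto
        simp: inverse_minus_one_quotient_def field_simps power2_eq_square)
qed

lemma integral_one_minus_divergence_eq_0:
  assumes diagonal: "\<And>i. i < n \<Longrightarrow> e i i = 1"
    and integrable: "integrable (jacobi_measure n) (selberg_weight n e)"
    and integrable_inverse:
      "\<And>i. i < n \<Longrightarrow> integrable (jacobi_measure n) (\<lambda>x. selberg_weight n e x * (1 / x i))"
  shows "(\<integral>x. selberg_weight n e x * exponent_sum n e one_minus_quotient x \<partial>jacobi_measure n) = 0"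
proof -
  define \<epsilon> where "\<epsilon> k = inverse (real (Suc k))" for k
  have \<epsilon>_bounds: "0 < \<epsilon> k" "\<epsilon> k \<le> 1" for k
    by (simp_all add: \<epsilon>_def inverse_le_1_iff)
  have \<epsilon>_tendsto: "\<epsilon> \<longlonglongrightarrow> 0"
    unfolding \<epsilon>_def by (rule LIMSEQ_inverse_real_of_nat)
  show ?thesis
  proof (rule integral_divergence_limit_eq_0[OF tangential_field_shift[OF \<epsilon>_bounds(1)] diagonal
        integrable, where q = "\<lambda>z. 2 / z"])
    show "integrable (jacobi_measure n) (\<lambda>x. selberg_weight n e x * (2 / x i))" if "i < n" for i
      using integrable_mult_right[OF integrable_inverse[OF that], of 2] by (simp add: mult.commute)
    fix z w :: real
    assume zw: "z \<in> {0<..1}" "w \<in> {0..1}"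
    show "\<bar>\<epsilon> k * (1 + \<epsilon> k) / ((z + \<epsilon> k) * (w + \<epsilon> k)) - 1\<bar> \<le> 2 / z + 2 / w" for k
      using abs_shift_quotient_le[OF zw \<epsilon>_bounds, of k] zw(2)
      by (intro order_trans[OF _ add_increasing2]) auto
    show "(\<lambda>k. \<epsilon> k * (1 + \<epsilon> k) / ((z + \<epsilon> k) * (w + \<epsilon> k)) - 1) \<longlonglongrightarrow> one_minus_quotient z w"
      by (rule shift_quotient_tendsto[OF zw \<epsilon>_bounds(1) \<epsilon>_tendsto])
  qed
qed

lemma integral_inverse_minus_one_divergence_eq_0:
  assumes diagonal: "\<And>i. i < n \<Longrightarrow> e i i = 1"
    and integrable: "integrable (jacobi_measure n) (selberg_weight n e)"
    and integrable_inverse_square: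
      "\<And>i. i < n \<Longrightarrow> integrable (jacobi_measure n) (\<lambda>x. selberg_weight n e x * (1 / (x i)\<^sup>2))"
  shows "(\<integral>x. selberg_weight n e x * exponent_sum n e inverse_minus_one_quotient x
    \<partial>jacobi_measure n) = 0"
proof -
  define \<epsilon> where "\<epsilon> k = inverse (real (Suc k))" for k
  have \<epsilon>_pos: "0 < \<epsilon> k" for k
    by (simp add: \<epsilon>_def)
  have \<epsilon>_tendsto: "\<epsilon> \<longlonglongrightarrow> 0"
    unfolding \<epsilon>_def by (rule LIMSEQ_inverse_real_of_nat)
  show ?thesis
  proof (rule integral_divergence_limit_eq_0[OF tangential_field_square_shift[OF \<epsilon>_pos] diagonal
        integrable, where q = "\<lambda>z. 2 / z\<^sup>2"])
    show "integrable (jacobi_measure n) (\<lambda>x. selberg_weight n e x * (2 / (x i)\<^sup>2))" if "i < n" for i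
      using integrable_mult_right[OF integrable_inverse_square[OF that], of 2]
      by (simp add: mult.commute)
    fix z w :: real
    assume zw: "z \<in> {0<..1}" "w \<in> {0..1}"
    show "\<bar>(\<epsilon> k * (1 - z - w) - z * w) / ((z\<^sup>2 + \<epsilon> k) * (w\<^sup>2 + \<epsilon> k))\<bar> \<le> 2 / z\<^sup>2 + 2 / w\<^sup>2" for k
      by (rule abs_square_shift_quotient_le[OF zw \<epsilon>_pos])
    show "(\<lambda>k. (\<epsilon> k * (1 - z - w) - z * w) / ((z\<^sup>2 + \<epsilon> k) * (w\<^sup>2 + \<epsilon> k)))
        \<longlonglongrightarrow> inverse_minus_one_quotient z w"
      by (rule square_shift_quotient_tendsto[OF zw \<epsilon>_pos \<epsilon>_tendsto])
  qed
qed

subsection \<open>Necessary conditions for convergence\<close>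

definition generic :: "'i set \<Rightarrow> ('i \<Rightarrow> real) \<Rightarrow> bool" where
  "generic J x \<longleftrightarrow> (\<forall>j\<in>J. 0 < x j \<and> x j < 1) \<and> inj_on x J"

lemma AE_unit_lborel_interior: "AE z in unit_lborel. 0 < z \<and> z < 1"
proof -
  have "AE z in lborel. z \<in> {0..1::real} \<longrightarrow> 0 < z \<and> z < 1"
    using AE_lborel_singleton[of "0::real"] AE_lborel_singleton[of "1::real"]
    by eventually_elim auto
  then show ?thesis
    by (subst AE_restrict_space_iff) auto
qed

lemma AE_unit_product_neq:
  assumes "finite I" "i \<in> I" "j \<in> I" "i \<noteq> j"
  shows "AE x in PiM I (\<lambda>_. unit_lborel). x i \<noteq> x j"
proof -
  have insert_eq: "insert i (I - {i}) = I"
    using assms by auto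
  have "AE x in PiM (insert i (I - {i})) (\<lambda>_. unit_lborel). x i \<noteq> x j"
  proof (rule product_sigma_finite.AE_PiM_insert[OF product_sigma_finite_unit_lborel])
    show "Measurable.pred (PiM (insert i (I - {i})) (\<lambda>_. unit_lborel)) (\<lambda>x. x i \<noteq> x j)"
      unfolding insert_eq pred_def using assms
      by (intro borel_measurable_neq measurable_unit_product_coordinate)
    fix x
    have "AE z in unit_lborel. z \<noteq> x j"
      using AE_lborel_singleton[of "x j"] by (subst AE_restrict_space_iff) auto
    then show "AE z in unit_lborel. (x(i := z)) i \<noteq> (x(i := z)) j"
      using \<open>i \<noteq> j\<close> by simp
  qed (use assms in auto)
  then show ?thesis
    by (simp only: insert_eq)
qed

lemma AE_generic:
  assumes "finite J"
  shows "AE x in PiM J (\<lambda>_. unit_lborel). generic J x"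
proof -
  have "AE x in PiM J (\<lambda>_. unit_lborel). \<forall>j\<in>J. 0 < x j \<and> x j < 1"
    unfolding AE_finite_all[OF assms] using prob_space_unit_lborel AE_unit_lborel_interior
    by (intro ballI AE_PiM_component)
  moreover have "AE x in PiM J (\<lambda>_. unit_lborel). \<forall>i\<in>J. \<forall>j\<in>J. i \<noteq> j \<longrightarrow> x i \<noteq> x j"
    using assms by (simp add: AE_finite_all AE_unit_product_neq)
  ultimately show ?thesis
    by eventually_elim (auto simp: generic_def inj_on_def)
qed

lemma generic_imp_inj_on_node:
  assumes "generic J x" "J \<subseteq> {..<n}"
  shows "inj_on (node n x) (J \<union> {n, Suc n})"
  using assms by (fastforce simp: generic_def node_def inj_on_def)

lemma integral_selberg_weight_pos:
  assumes "integrable (jacobi_measure n) (selberg_weight n e)"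
  shows "0 < (\<integral>x. selberg_weight n e x \<partial>jacobi_measure n)"
proof -
  interpret prob_space "jacobi_measure n"
    by (rule prob_space_jacobi_measure)
  have "AE x in jacobi_measure n. generic {..<n} x"
    unfolding jacobi_measure_eq_PiM by (rule AE_generic) simp
  then have "AE x in jacobi_measure n. 0 < selberg_weight n e x"
  proof eventually_elim
    case (elim x)
    have "{..<n} \<union> {n, Suc n} = {..<n + 2}"
      by auto
    with generic_imp_inj_on_node[OF elim order_refl] have inj: "inj_on (node n x) {..<n + 2}"
      by (simp only:)
    show ?case
      by (intro power_product_pos inj_on_contraD[OF inj]) (auto simp: node_pairs_def)
  qed
  with assms show ?thesis
    by (rule expectation_greater)
qed

lemma nn_integral_inverse_distance:
  fixes a b :: real
  assumes "a < b"
  shows "(\<integral>\<^sup>+y. ennreal (1 / (y - a)) * indicator {a<..b} y \<partial>lborel) = \<infinity>" (is "?T = _")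
proof -
  have "of_nat N \<le> ?T" for N :: nat
  proof -
    define s where "s = a + (b - a) * exp (- real N)"
    have "(b - a) * exp (- real N) \<le> b - a" "0 < (b - a) * exp (- real N)"
      using assms by (auto intro!: mult_left_le)
    then have s_bounds: "a < s" "s \<le> b"
      unfolding s_def by linarith+
    have "(\<integral>\<^sup>+y. ennreal (1 / (y - a)) * indicator {s..b} y \<partial>lborel)
        = ennreal (ln (b - a) - ln (s - a))"
    proof (rule nn_integral_FTC_Icc)
      show "((\<lambda>y. ln (y - a)) has_real_derivative 1 / (y - a)) (at y)" if "y \<in> {s..b}" for y
        using that s_bounds by (auto intro!: derivative_eq_intros simp: field_simps)
    qed (use s_bounds in auto)
    also have "ln (b - a) - ln (s - a) = real N"
      using assms by (simp add: s_def ln_mult)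
    finally have "of_nat N = (\<integral>\<^sup>+y. ennreal (1 / (y - a)) * indicator {s..b} y \<partial>lborel)"
      by (simp add: ennreal_of_nat_eq_real_of_nat)
    also have "\<dots> \<le> ?T"
      using s_bounds by (intro nn_integral_mono) (auto simp: indicator_def)
    finally show ?thesis .
  qed
  then have "(SUP N. of_nat N) \<le> ?T"
    by (rule SUP_least)
  then show ?thesis
    unfolding ennreal_SUP_of_nat_eq_top top_unique by simp
qed

lemma integrable_powr_mult_imp_exponent_gt:
  fixes g :: "real \<Rightarrow> real"
  assumes p_unit: "0 \<le> p" "p < 1"
    and integrable: "integrable unit_lborel (\<lambda>y. \<bar>y - p\<bar> powr s * g y)"
    and g_tendsto: "(g \<longlongrightarrow> l) (at_right p)" and l_pos: "0 < l"
  shows "- 1 < s"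
proof (rule ccontr)
  assume s_le: "\<not> - 1 < s"
  have "\<forall>\<^sub>F y in at_right p. l / 2 < g y"
    using g_tendsto l_pos by (intro order_tendstoD(1)) auto
  then obtain b where "p < b" and g_gt: "\<And>y. p < y \<Longrightarrow> y < b \<Longrightarrow> l / 2 < g y"
    unfolding eventually_at_right_field by blast
  define r where "r = (p + min b 1) / 2"
  have r_bounds: "p < r" "r < b" "r < 1"
    using p_unit \<open>p < b\<close> by (auto simp: r_def min_def)
  have lower_bound: "l / 2 * (1 / (y - p)) \<le> \<bar>\<bar>y - p\<bar> powr s * g y\<bar>" if "y \<in> {p<..r}" for y
  proof -
    have "1 / (y - p) = (y - p) powr (- 1)"
      using that by (simp add: powr_minus_divide)
    also have "\<dots> \<le> (y - p) powr s"
      using that s_le p_unit r_bounds by (intro powr_mono') auto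
    finally have "1 / (y - p) * (l / 2) \<le> \<bar>y - p\<bar> powr s * g y"
      using that g_gt[of y] r_bounds l_pos by (intro mult_mono) auto
    then show ?thesis
      by (simp add: mult.commute)
  qed
  have ennreal_split: "ennreal (l / 2 * (1 / (y - p))) = ennreal (l / 2) * ennreal (1 / (y - p))"
    for y
    using l_pos by (intro ennreal_mult') simp
  have "\<infinity> = ennreal (l / 2) * (\<integral>\<^sup>+y. ennreal (1 / (y - p)) * indicator {p<..r} y \<partial>lborel)"
    using l_pos r_bounds by (simp add: nn_integral_inverse_distance ennreal_mult_top)
  also have "\<dots> = (\<integral>\<^sup>+y. ennreal (l / 2 * (1 / (y - p))) * indicator {p<..r} y \<partial>lborel)"
    unfolding ennreal_split mult.assoc by (rule nn_integral_cmult[symmetric]) measurable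
  also have "\<dots> \<le> (\<integral>\<^sup>+y. ennreal (norm (\<bar>y - p\<bar> powr s * g y)) * indicator {0..1} y \<partial>lborel)"
    using lower_bound p_unit r_bounds
    by (intro nn_integral_mono) (auto simp: indicator_def intro!: ennreal_leI)
  also have "\<dots> < \<infinity>"
    using integrable by (simp add: integrable_iff_bounded nn_integral_restrict_space)
  finally show False by simp
qed

lemma power_product_fun_upd_tendsto:
  assumes "\<And>a b. (a, b) \<in> P \<Longrightarrow> node n x a \<noteq> node n x b"
  shows "((\<lambda>y. power_product n e P (x(i := y))) \<longlongrightarrow> power_product n e P x) (at (x i))"
proof -
  have node_tendsto: "((\<lambda>y. node n (x(i := y)) k) \<longlongrightarrow> node n x k) (at (x i))" for k
    by (cases "k = i") (auto simp: node_def)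
  show ?thesis
    unfolding power_product_def case_prod_beta
    by (intro tendsto_prod tendsto_powr tendsto_rabs tendsto_diff node_tendsto tendsto_const)
      (use assms in force)
qed

lemma exists_generic_integrable_section:
  fixes f :: "(nat \<Rightarrow> real) \<Rightarrow> real"
  assumes "integrable (jacobi_measure n) f" "i < n"
  obtains x where "generic ({..<n} - {i}) x" "integrable unit_lborel (\<lambda>y. f (x(i := y)))"
proof -
  let ?P = "PiM ({..<n} - {i}) (\<lambda>_. unit_lborel)"
  interpret prob_space ?P
    by (intro prob_space_PiM prob_space_unit_lborel)
  have "integrable (PiM (insert i ({..<n} - {i})) (\<lambda>_. unit_lborel)) f"
    using assms by (simp add: jacobi_measure_eq_PiM insert_absorb)
  from product_sigma_finite.AE_integrable_fun_upd[OF product_sigma_finite_unit_lborel _ _ this]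
  have "AE x in ?P. generic ({..<n} - {i}) x \<and> integrable unit_lborel (\<lambda>y. f (x(i := y)))"
    using AE_generic[of "{..<n} - {i}"] by simp
  then show thesis
    using ae_filter_bot eventually_happens' that by blast
qed

definition pair_exponent :: "nat \<Rightarrow> (nat \<Rightarrow> nat \<Rightarrow> real) \<Rightarrow> nat \<Rightarrow> nat \<Rightarrow> real" where
  "pair_exponent n e i k = e i k + (if k < n then e k i else 0)"

lemma selberg_weight_remove_pair:
  assumes "i < n" "k < n + 2" "i \<noteq> k"
  shows "selberg_weight n e x = \<bar>node n x i - node n x k\<bar> powr pair_exponent n e i k *
    power_product n e (node_pairs n - {(i, k), (k, i)}) x"
proof (cases "k < n")
  case True
  then have "(i, k) \<in> node_pairs n" "(k, i) \<in> node_pairs n - {(i, k)}"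
    and "node_pairs n - {(i, k), (k, i)} = node_pairs n - {(i, k)} - {(k, i)}"
    using assms by (auto simp: node_pairs_def)
  then show ?thesis
    using True by (simp add: power_product_remove[of _ i k] power_product_remove[of _ k i]
        pair_exponent_def powr_add abs_minus_commute mult.assoc)
next
  case False
  then have "(i, k) \<in> node_pairs n" "node_pairs n - {(i, k), (k, i)} = node_pairs n - {(i, k)}"
    using assms by (auto simp: node_pairs_def)
  then show ?thesis
    using False by (simp add: power_product_remove[of _ i k] pair_exponent_def)
qed

lemma integrable_selberg_weight_imp_pair_exponent_gt:
  assumes integrable: "integrable (jacobi_measure n) (selberg_weight n e)"
    and indices: "i < n" "k \<le> n" "i \<noteq> k"
  shows "- 1 < pair_exponent n e i k"
proof -
  let ?J = "{..<n} - {i}" and ?P = "node_pairs n - {(i, k), (k, i)}"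
  obtain x where x_generic: "generic ?J x"
      and section_integrable: "integrable unit_lborel (\<lambda>y. selberg_weight n e (x(i := y)))"
    using integrable indices(1) by (rule exists_generic_integrable_section)
  define z where "z = x(i := node n x k)"
  have z_i: "z i = node n x k" and upd_z: "x(i := y) = z(i := y)" for y
    by (simp_all add: z_def)
  have "?J \<union> {n, Suc n} = {..<n + 2} - {i}"
    using indices(1) by auto
  with generic_imp_inj_on_node[OF x_generic Diff_subset]
  have inj: "inj_on (node n x) ({..<n + 2} - {i})"
    by (simp only:)
  have node_z: "node n z a = node n x (if a = i then k else a)" for a
    using indices by (simp add: z_def node_def)
  have distinct: "node n z a \<noteq> node n z b" if "(a, b) \<in> ?P" for a b
    unfolding node_z using that indices
    by (intro inj_on_contraD[OF inj]) (auto simp: node_pairs_def)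
  have nodes_upd: "node n (z(i := y)) i = y" "node n (z(i := y)) k = node n x k" for y
    using indices by (simp_all add: node_def z_def)
  show ?thesis
  proof (rule integrable_powr_mult_imp_exponent_gt)
    show "0 \<le> node n x k" "node n x k < 1"
      using x_generic indices by (auto simp: node_def generic_def less_imp_le)
    show "integrable unit_lborel
        (\<lambda>y. \<bar>y - node n x k\<bar> powr pair_exponent n e i k * power_product n e ?P (z(i := y)))"
      using section_integrable selberg_weight_remove_pair[of i n k e] indices
      by (simp add: upd_z nodes_upd)
    show "((\<lambda>y. power_product n e ?P (z(i := y))) \<longlongrightarrow> power_product n e ?P z) (at_right (node n x k))"
      using power_product_fun_upd_tendsto[OF distinct, where i = i] unfolding z_i[symmetric]
      by (rule filterlim_mono) (auto intro: at_le)
    show "0 < power_product n e ?P z"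
      by (rule power_product_pos[OF distinct])
  qed
qed

subsection \<open>Linear relations between inverse moments\<close>

lemma integrable_selberg_weight_inverse_product:
  assumes indices: "i < n" "j < n"
    and integrable: "\<And>i. i < n \<Longrightarrow>
      integrable (jacobi_measure n) (\<lambda>x. selberg_weight n e x * (1 / (x i)\<^sup>2))"
  shows "integrable (jacobi_measure n) (\<lambda>x. selberg_weight n e x * (1 / (x i * x j)))"
proof (rule Bochner_Integration.integrable_bound)
  show "integrable (jacobi_measure n)
      (\<lambda>x. selberg_weight n e x * (1 / (x i)\<^sup>2) + selberg_weight n e x * (1 / (x j)\<^sup>2))"
    by (intro Bochner_Integration.integrable_add integrable indices)
  have "\<bar>p * q\<bar> \<le> p\<^sup>2 + q\<^sup>2" for p q :: real
    using sum_squares_bound[of p q] sum_squares_bound[of p "- q"] by (auto simp: abs_le_iff)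
  from this[of "1 / x i" "1 / x j" for x]
  have "\<bar>1 / (x i * x j)\<bar> \<le> 1 / (x i)\<^sup>2 + 1 / (x j)\<^sup>2" for x :: "nat \<Rightarrow> real"
    by (simp add: power_divide)
  then show "AE x in jacobi_measure n. norm (selberg_weight n e x * (1 / (x i * x j)))
      \<le> norm (selberg_weight n e x * (1 / (x i)\<^sup>2) + selberg_weight n e x * (1 / (x j)\<^sup>2))"
    unfolding distrib_left[symmetric] real_norm_def abs_mult[of "selberg_weight n e _"]
    by (intro AE_I2 mult_left_mono order_trans[OF _ abs_ge_self])
      (auto simp: power_product_nonneg)
  show "(\<lambda>x. selberg_weight n e x * (1 / (x i * x j))) \<in> borel_measurable (jacobi_measure n)"
    using indices
    by (intro borel_measurable_times borel_measurable_divide measurable_coordinate) auto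
qed

lemma integrable_selberg_weight_inverse:
  assumes "i < n"
    and integrable: "integrable (jacobi_measure n) (\<lambda>x. selberg_weight n e x * (1 / (x i)\<^sup>2))"
  shows "integrable (jacobi_measure n) (\<lambda>x. selberg_weight n e x * (1 / x i))"
proof (rule Bochner_Integration.integrable_bound[OF integrable])
  have "\<bar>1 / x i\<bar> \<le> 1 / (x i)\<^sup>2" if "x \<in> space (jacobi_measure n)" for x
    using space_jacobi_measureD[OF that \<open>i < n\<close>]
    by (cases "x i = 0")
      (auto intro!: divide_left_mono simp: power2_eq_square mult_left_le_one_le)
  then show "AE x in jacobi_measure n. norm (selberg_weight n e x * (1 / x i))
      \<le> norm (selberg_weight n e x * (1 / (x i)\<^sup>2))"
    by (intro AE_I2)
      (simp add: abs_mult mult_left_mono power_product_nonneg del: times_divide_eq_right)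
  show "(\<lambda>x. selberg_weight n e x * (1 / x i)) \<in> borel_measurable (jacobi_measure n)"
    using \<open>i < n\<close>
    by (intro borel_measurable_times borel_measurable_divide measurable_coordinate) auto
qed

lemma exponent_sum_one_minus_quotient:
  assumes x_pos: "\<And>i. i < n \<Longrightarrow> 0 < x i"
  shows "exponent_sum n e one_minus_quotient x
    = (\<Sum>i<n. e i n * (1 / x i)) - (\<Sum>i<n. \<Sum>j<n + 2. e i j)"
proof -
  have "(\<Sum>j<n + 2. e i j * one_minus_quotient (node n x i) (node n x j))
      = e i n * (1 / x i) - (\<Sum>j<n + 2. e i j)" if "i < n" for i
  proof -
    have "(\<Sum>j<n. e i j * one_minus_quotient (node n x i) (node n x j)) = - (\<Sum>j<n. e i j)"
      using x_pos unfolding sum_negf[symmetric]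
      by (intro sum.cong) (force simp: node_def one_minus_quotient_def)+
    then show ?thesis
      using that by (simp add: node_def one_minus_quotient_def right_diff_distrib)
  qed
  then show ?thesis
    by (simp add: exponent_sum_def sum_subtractf del: sum.lessThan_Suc)
qed

lemma exponent_sum_inverse_minus_one_quotient:
  assumes x_pos: "\<And>i. i < n \<Longrightarrow> 0 < x i"
  shows "exponent_sum n e inverse_minus_one_quotient x = (\<Sum>i<n. e i n * (1 / (x i)\<^sup>2))
    - (\<Sum>i<n. (e i n + e i (Suc n)) * (1 / x i)) - (\<Sum>i<n. \<Sum>j<n. e i j * (1 / (x i * x j)))"
proof -
  have "(\<Sum>j<n + 2. e i j * inverse_minus_one_quotient (node n x i) (node n x j))
      = e i n * (1 / (x i)\<^sup>2) - (e i n + e i (Suc n)) * (1 / x i)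
        - (\<Sum>j<n. e i j * (1 / (x i * x j)))" if "i < n" for i
  proof -
    have "(\<Sum>j<n. e i j * inverse_minus_one_quotient (node n x i) (node n x j))
        = - (\<Sum>j<n. e i j * (1 / (x i * x j)))"
      using x_pos that unfolding sum_negf[symmetric]
      by (intro sum.cong) (force simp: node_def inverse_minus_one_quotient_def)+
    then show ?thesis
      using that
      by (simp add: node_def inverse_minus_one_quotient_def right_diff_distrib add_divide_distrib
          cong: if_cong)
  qed
  then show ?thesis
    by (simp add: exponent_sum_def sum_subtractf del: sum.lessThan_Suc)
qed

lemma selberg_inverse_relation:
  assumes "\<And>i. i < n \<Longrightarrow> e i i = 1"
    and integrable: "integrable (jacobi_measure n) (selberg_weight n e)"
    and integrable_inverse:
      "\<And>i. i < n \<Longrightarrow> integrable (jacobi_measure n) (\<lambda>x. selberg_weight n e x * (1 / x i))"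
  shows "(\<Sum>i<n. e i n * (\<integral>x. selberg_weight n e x * (1 / x i) \<partial>jacobi_measure n))
    = (\<Sum>i<n. \<Sum>j<n + 2. e i j) * (\<integral>x. selberg_weight n e x \<partial>jacobi_measure n)"
proof -
  let ?M = "jacobi_measure n" and ?W = "selberg_weight n e"
  let ?total = "\<Sum>i<n. \<Sum>j<n + 2. e i j"
  have integrable_sum: "integrable ?M (\<lambda>x. \<Sum>i<n. e i n * (?W x * (1 / x i)))"
    using integrable_inverse
    by (intro Bochner_Integration.integrable_sum integrable_mult_right) auto
  have "0 = (\<integral>x. ?W x * exponent_sum n e one_minus_quotient x \<partial>?M)"
    using assms by (rule integral_one_minus_divergence_eq_0[symmetric])
  also have "\<dots> = (\<integral>x. (\<Sum>i<n. e i n * (?W x * (1 / x i))) - ?total * ?W x \<partial>?M)"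
  proof (rule Bochner_Integration.integral_cong[OF refl])
    fix x assume "x \<in> space ?M"
    then have "?W x * exponent_sum n e one_minus_quotient x
        = ?W x * ((\<Sum>i<n. e i n * (1 / x i)) - ?total)"
      by (intro selberg_weight_mult_cong exponent_sum_one_minus_quotient)
    then show "?W x * exponent_sum n e one_minus_quotient x
        = (\<Sum>i<n. e i n * (?W x * (1 / x i))) - ?total * ?W x"
      by (simp only: right_diff_distrib sum_distrib_left mult_ac)
  qed
  also have "\<dots> = (\<Sum>i<n. e i n * (\<integral>x. ?W x * (1 / x i) \<partial>?M)) - ?total * (\<integral>x. ?W x \<partial>?M)"
    using integrable integrable_inverse integrable_sum
    by (simp add: Bochner_Integration.integral_sum del: times_divide_eq_right sum.lessThan_Suc)
  finally show ?thesis by simp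
qed

lemma selberg_inverse_square_relation:
  assumes "\<And>i. i < n \<Longrightarrow> e i i = 1"
    and "integrable (jacobi_measure n) (selberg_weight n e)"
    and integrable_inverse_square:
      "\<And>i. i < n \<Longrightarrow> integrable (jacobi_measure n) (\<lambda>x. selberg_weight n e x * (1 / (x i)\<^sup>2))"
  shows "(\<Sum>i<n. e i n * (\<integral>x. selberg_weight n e x * (1 / (x i)\<^sup>2) \<partial>jacobi_measure n))
    = (\<Sum>i<n. (e i n + e i (Suc n)) * (\<integral>x. selberg_weight n e x * (1 / x i) \<partial>jacobi_measure n))
    + (\<Sum>i<n. \<Sum>j<n. e i j * (\<integral>x. selberg_weight n e x * (1 / (x i * x j)) \<partial>jacobi_measure n))"
proof -
  let ?M = "jacobi_measure n" and ?W = "selberg_weight n e"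
  let ?A = "\<lambda>x. \<Sum>i<n. e i n * (?W x * (1 / (x i)\<^sup>2))"
    and ?B = "\<lambda>x. \<Sum>i<n. (e i n + e i (Suc n)) * (?W x * (1 / x i))"
    and ?C = "\<lambda>x. \<Sum>i<n. \<Sum>j<n. e i j * (?W x * (1 / (x i * x j)))"
  note integrable_summands = integrable_inverse_square
    integrable_selberg_weight_inverse[OF _ integrable_inverse_square]
    integrable_selberg_weight_inverse_product[OF _ _ integrable_inverse_square]
  have integrable_row: "integrable ?M (\<lambda>x. \<Sum>j<n. e i j * (?W x * (1 / (x i * x j))))"
    if "i < n" for i
    using that integrable_summands
    by (intro Bochner_Integration.integrable_sum integrable_mult_right) auto
  have integrable_sums: "integrable ?M ?A" "integrable ?M ?B" "integrable ?M ?C"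
    using integrable_summands
    by (auto intro!: Bochner_Integration.integrable_sum integrable_mult_right
        simp del: times_divide_eq_right)
  have "0 = (\<integral>x. ?W x * exponent_sum n e inverse_minus_one_quotient x \<partial>?M)"
    using assms by (rule integral_inverse_minus_one_divergence_eq_0[symmetric])
  also have "\<dots> = (\<integral>x. ?A x - ?B x - ?C x \<partial>?M)"
  proof (rule Bochner_Integration.integral_cong[OF refl])
    fix x assume "x \<in> space ?M"
    then have "?W x * exponent_sum n e inverse_minus_one_quotient x
        = ?W x * ((\<Sum>i<n. e i n * (1 / (x i)\<^sup>2)) - (\<Sum>i<n. (e i n + e i (Suc n)) * (1 / x i))
          - (\<Sum>i<n. \<Sum>j<n. e i j * (1 / (x i * x j))))"
      by (intro selberg_weight_mult_cong exponent_sum_inverse_minus_one_quotient)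
    then show "?W x * exponent_sum n e inverse_minus_one_quotient x = ?A x - ?B x - ?C x"
      by (simp only: right_diff_distrib sum_distrib_left mult.left_commute)
  qed
  also have "\<dots> = integral\<^sup>L ?M ?A - integral\<^sup>L ?M ?B - integral\<^sup>L ?M ?C"
    using integrable_sums by simp
  finally show ?thesis
    using integrable_summands integrable_row
    by (simp add: Bochner_Integration.integral_sum del: times_divide_eq_right)
qed

subsection \<open>Symmetric weights\<close>

lemma selberg_weight_permute:
  assumes permutes: "\<pi> permutes {..<n}"
    and invariant: "\<And>i j. e (\<pi> i) (\<pi> j) = e i j"
  shows "selberg_weight n e (\<lambda>j\<in>{..<n}. x (\<pi> j)) = selberg_weight n e x"
proof -
  have less_iff: "\<pi> j < m \<longleftrightarrow> j < m" if "n \<le> m" for j m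
    using permutes_in_image[OF permutes_subset[OF permutes, of "{..<m}"], of j] that by simp
  have node_permute: "node n (\<lambda>j\<in>{..<n}. x (\<pi> j)) j = node n x (\<pi> j)" for j
    using permutes_not_in[OF permutes, of j] by (cases "j < n") (simp_all add: node_def less_iff)
  have "map_prod \<pi> \<pi> ` node_pairs n \<subseteq> node_pairs n"
    using permutes_inj[OF permutes] by (auto simp: node_pairs_def less_iff inj_eq)
  moreover have "inj_on (map_prod \<pi> \<pi>) (node_pairs n)"
    using permutes_inj[OF permutes] by (meson inj_on_subset prod.inj_map subset_UNIV)
  ultimately have "bij_betw (map_prod \<pi> \<pi>) (node_pairs n) (node_pairs n)"
    by (simp add: bij_betw_def endo_inj_surj)
  from prod.reindex_bij_betw[OF this, of "\<lambda>(i, j). \<bar>node n x i - node n x j\<bar> powr e i j"]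
  show ?thesis
    by (simp add: power_product_def node_permute invariant case_prod_beta)
qed

lemma distr_jacobi_measure_permute:
  assumes "\<pi> permutes {..<n}"
  shows "distr (jacobi_measure n) (jacobi_measure n) (\<lambda>x. \<lambda>j\<in>{..<n}. x (\<pi> j)) = jacobi_measure n"
  unfolding jacobi_measure_def
proof (rule distr_PiM_reindex)
  show "\<pi> \<in> {..<n} \<rightarrow> {..<n}"
    using permutes_in_image[OF assms] by auto
qed (auto intro: prob_space_unit_lborel permutes_inj_on[OF assms])

lemma
  fixes F G :: "(nat \<Rightarrow> real) \<Rightarrow> real"
  assumes permutes: "\<pi> permutes {..<n}"
    and invariant: "\<And>i j. e (\<pi> i) (\<pi> j) = e i j"
    and [measurable]: "F \<in> borel_measurable (jacobi_measure n)"
    and F_permute: "\<And>x. F (\<lambda>j\<in>{..<n}. x (\<pi> j)) = G x"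
  shows integrable_selberg_weight_permute:
      "integrable (jacobi_measure n) (\<lambda>x. selberg_weight n e x * G x)
        \<longleftrightarrow> integrable (jacobi_measure n) (\<lambda>x. selberg_weight n e x * F x)"
    and integral_selberg_weight_permute:
      "(\<integral>x. selberg_weight n e x * G x \<partial>jacobi_measure n)
        = (\<integral>x. selberg_weight n e x * F x \<partial>jacobi_measure n)"
proof -
  let ?M = "jacobi_measure n" and ?W = "selberg_weight n e" and ?T = "\<lambda>x. \<lambda>j\<in>{..<n}. x (\<pi> j)"
  have measurable_T: "?T \<in> ?M \<rightarrow>\<^sub>M ?M"
    unfolding jacobi_measure_def using permutes_in_image[OF permutes]
    by (intro measurable_restrict measurable_component_singleton) auto
  have measurable_WF: "(\<lambda>x. ?W x * F x) \<in> borel_measurable ?M"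
    by measurable
  have WF_permute: "?W (?T x) * F (?T x) = ?W x * G x" for x
    by (simp only: selberg_weight_permute[where e = e, OF permutes invariant] F_permute)
  show "integrable ?M (\<lambda>x. ?W x * G x) \<longleftrightarrow> integrable ?M (\<lambda>x. ?W x * F x)"
    using integrable_distr_eq[OF measurable_T measurable_WF]
    unfolding distr_jacobi_measure_permute[OF permutes] WF_permute by simp
  show "(\<integral>x. ?W x * G x \<partial>?M) = (\<integral>x. ?W x * F x \<partial>?M)"
    using integral_distr[OF measurable_T measurable_WF]
    unfolding distr_jacobi_measure_permute[OF permutes] WF_permute by simp
qed

subsection \<open>The Jacobi weight\<close>

definition jacobi_exponent :: "nat \<Rightarrow> real \<Rightarrow> real \<Rightarrow> real \<Rightarrow> nat \<Rightarrow> nat \<Rightarrow> real" where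
  "jacobi_exponent n \<alpha> \<beta> \<gamma> i j =
     (if i = j then 1 else if j < n then \<gamma> else if j = n then \<alpha> - 1 else \<beta> - 1)"

lemma prod_unordered_pairs:
  fixes g :: "nat \<Rightarrow> nat \<Rightarrow> 'a :: comm_monoid_mult"
  assumes symmetric: "\<And>i j. g i j = g j i"
  shows "(\<Prod>i<n. \<Prod>j\<in>{i<..<n}. g i j * g i j) = (\<Prod>i<n. \<Prod>j\<in>{..<n} - {i}. g i j)"
proof -
  have "(\<Prod>i<n. \<Prod>j\<in>{..<n} - {i}. g i j) = (\<Prod>i<n. (\<Prod>j<i. g i j) * (\<Prod>j\<in>{i<..<n}. g i j))"
  proof (rule prod.cong[OF refl])
    fix i assume "i \<in> {..<n}"
    then have remove_eq: "{..<n} - {i} = {..<i} \<union> {i<..<n}"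
      by auto
    show "(\<Prod>j\<in>{..<n} - {i}. g i j) = (\<Prod>j<i. g i j) * (\<Prod>j\<in>{i<..<n}. g i j)"
      unfolding remove_eq by (rule prod.union_disjoint) auto
  qed
  also have "\<dots> = (\<Prod>i<n. \<Prod>j<i. g i j) * (\<Prod>i<n. \<Prod>j\<in>{i<..<n}. g i j)"
    by (rule prod.distrib)
  also have "(\<Prod>i<n. \<Prod>j<i. g i j) = (\<Prod>i<n. \<Prod>j\<in>{j. j \<in> {..<n} \<and> j < i}. g i j)"
    by (intro prod.cong) auto
  also have "\<dots> = (\<Prod>j<n. \<Prod>i\<in>{i. i \<in> {..<n} \<and> j < i}. g i j)"
    by (rule prod.swap_restrict) auto
  also have "\<dots> = (\<Prod>j<n. \<Prod>i\<in>{j<..<n}. g j i)"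
    using symmetric by (intro prod.cong) auto
  finally show ?thesis
    by (simp add: prod.distrib)
qed

lemma jacobi_weight_eq_selberg_weight:
  assumes x_space: "x \<in> space (jacobi_measure n)"
  shows "jacobi_weight n \<alpha> \<beta> \<gamma> x = selberg_weight n (jacobi_exponent n \<alpha> \<beta> \<gamma>) x"
proof -
  let ?f = "\<lambda>i j. \<bar>node n x i - node n x j\<bar> powr jacobi_exponent n \<alpha> \<beta> \<gamma> i j"
  have node_pairs_eq: "node_pairs n = Sigma {..<n} (\<lambda>i. {..<n + 2} - {i})"
    by (auto simp: node_pairs_def)
  have row_eq: "(\<Prod>j\<in>{..<n + 2} - {i}. ?f i j)
      = (\<Prod>j\<in>{..<n} - {i}. \<bar>x i - x j\<bar> powr \<gamma>) * x i powr (\<alpha> - 1) * (1 - x i) powr (\<beta> - 1)"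
    if "i < n" for i
  proof -
    have "{..<n + 2} - {i} = insert n (insert (Suc n) ({..<n} - {i}))"
      using that by auto
    moreover have "(\<Prod>j\<in>{..<n} - {i}. ?f i j) = (\<Prod>j\<in>{..<n} - {i}. \<bar>x i - x j\<bar> powr \<gamma>)"
      using that by (intro prod.cong) (auto simp: node_def jacobi_exponent_def)
    ultimately show ?thesis
      using that space_jacobi_measureD[OF x_space that]
      by (simp add: node_def jacobi_exponent_def abs_minus_commute mult_ac)
  qed
  have "selberg_weight n (jacobi_exponent n \<alpha> \<beta> \<gamma>) x = (\<Prod>i<n. \<Prod>j\<in>{..<n + 2} - {i}. ?f i j)"
    unfolding power_product_def node_pairs_eq by (rule prod.Sigma[symmetric]) auto
  also have "\<dots> = (\<Prod>i<n. \<Prod>j\<in>{..<n} - {i}. \<bar>x i - x j\<bar> powr \<gamma>) *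
      (\<Prod>i<n. x i powr (\<alpha> - 1)) * (\<Prod>i<n. (1 - x i) powr (\<beta> - 1))"
    unfolding prod.distrib[symmetric] by (intro prod.cong row_eq) auto
  also have "(\<Prod>i<n. \<Prod>j\<in>{..<n} - {i}. \<bar>x i - x j\<bar> powr \<gamma>)
      = (\<Prod>i<n. \<Prod>j\<in>{i<..<n}. \<bar>x i - x j\<bar> powr \<gamma> * \<bar>x i - x j\<bar> powr \<gamma>)"
    by (rule prod_unordered_pairs[symmetric]) (simp add: abs_minus_commute)
  finally show ?thesis
    by (simp add: jacobi_weight_def powr_add[symmetric])
qed

lemma jacobi_exponent_simps:
  assumes "i < n"
  shows "jacobi_exponent n \<alpha> \<beta> \<gamma> i i = 1" "jacobi_exponent n \<alpha> \<beta> \<gamma> i n = \<alpha> - 1"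
    "jacobi_exponent n \<alpha> \<beta> \<gamma> i (Suc n) = \<beta> - 1"
  using assms by (simp_all add: jacobi_exponent_def)

lemma jacobi_exponent_permute:
  assumes "\<pi> permutes {..<n}"
  shows "jacobi_exponent n \<alpha> \<beta> \<gamma> (\<pi> i) (\<pi> j) = jacobi_exponent n \<alpha> \<beta> \<gamma> i j"
  using permutes_in_image[OF assms, of j] permutes_not_in[OF assms, of j] permutes_inj[OF assms]
  by (cases "j < n") (auto simp: jacobi_exponent_def inj_eq)

lemma sum_jacobi_exponent_row:
  assumes "i < n"
  shows "(\<Sum>j<n. jacobi_exponent n \<alpha> \<beta> \<gamma> i j * f j) = f i + \<gamma> * (\<Sum>j\<in>{..<n} - {i}. f j)"
proof -
  have "(\<Sum>j\<in>{..<n} - {i}. jacobi_exponent n \<alpha> \<beta> \<gamma> i j * f j) = (\<Sum>j\<in>{..<n} - {i}. \<gamma> * f j)"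
    by (intro sum.cong) (auto simp: jacobi_exponent_def)
  then show ?thesis
    using assms by (subst sum.remove[of _ i]) (auto simp: jacobi_exponent_simps sum_distrib_left)
qed

lemma sum_jacobi_exponent:
  "(\<Sum>i<n. \<Sum>j<n + 2. jacobi_exponent n \<alpha> \<beta> \<gamma> i j)
    = real n * (\<alpha> + \<beta> + (real n - 1) * \<gamma> - 1)"
proof -
  have "(\<Sum>j<n + 2. jacobi_exponent n \<alpha> \<beta> \<gamma> i j) = \<alpha> + \<beta> + (real n - 1) * \<gamma> - 1" if "i < n" for i
    using sum_jacobi_exponent_row[OF that, of \<alpha> \<beta> \<gamma> "\<lambda>_. 1"] that
    by (simp add: jacobi_exponent_simps of_nat_diff mult.commute)
  then show ?thesis by simp
qed

lemma sum_shift_exponent: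
  assumes "k < n" "l < n + 2"
  shows "(\<Sum>i<n. \<Sum>j<n + 2. shift_exponent k l s e i j) = (\<Sum>i<n. \<Sum>j<n + 2. e i j) + s"
proof -
  have "(\<Sum>j<n + 2. shift_exponent k l s e i j) = (\<Sum>j<n + 2. e i j) + (if i = k then s else 0)" for i
  proof -
    have "shift_exponent k l s e i j = e i j + (if j = l then if i = k then s else 0 else 0)" for j
      by (simp add: shift_exponent_def)
    then show ?thesis
      using assms(2) by (simp only: sum.distrib sum.delta) simp
  qed
  then show ?thesis
    using assms(1) by (simp add: sum.distrib del: sum.lessThan_Suc)
qed

subsection \<open>Inverse moments\<close>

locale jacobi_inverse_square =
  fixes n :: nat and \<alpha> \<beta> \<gamma> :: real
  assumes n_ge_1: "1 \<le> n"
    and integrable_jacobi_weight: "integrable (jacobi_measure n) (jacobi_weight n \<alpha> \<beta> \<gamma>)"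
    and integrable_powr_jacobi_weight:
      "integrable (jacobi_measure n) (\<lambda>x. x 0 powr (-2) * jacobi_weight n \<alpha> \<beta> \<gamma> x)"
begin

abbreviation exponent :: "nat \<Rightarrow> nat \<Rightarrow> real" where
  "exponent \<equiv> jacobi_exponent n \<alpha> \<beta> \<gamma>"

abbreviation weight :: "(nat \<Rightarrow> real) \<Rightarrow> real" where
  "weight \<equiv> selberg_weight n exponent"

definition moment :: "((nat \<Rightarrow> real) \<Rightarrow> real) \<Rightarrow> real" where
  "moment f = (\<integral>x. weight x * f x \<partial>jacobi_measure n)"

definition inverse_moment :: real where
  "inverse_moment = moment (\<lambda>x. 1 / x 0)"

definition inverse_square_moment :: real where
  "inverse_square_moment = moment (\<lambda>x. 1 / (x 0)\<^sup>2)"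

text \<open>A junk value for \<open>n = 1\<close>, where it is only used multiplied by \<open>n - 1\<close>.\<close>

definition inverse_product_moment :: real where
  "inverse_product_moment = moment (\<lambda>x. 1 / (x 0 * x 1))"

lemma jacobi_avg_eq_moment:
  assumes "\<And>x. x \<in> space (jacobi_measure n) \<Longrightarrow> f x = g x"
  shows "jacobi_avg n \<alpha> \<beta> \<gamma> f = moment g / moment (\<lambda>_. 1)"
proof -
  have "(\<integral>x. f x * jacobi_weight n \<alpha> \<beta> \<gamma> x \<partial>jacobi_measure n) = moment g"
    "(\<integral>x. jacobi_weight n \<alpha> \<beta> \<gamma> x \<partial>jacobi_measure n) = moment (\<lambda>_. 1)"
    unfolding moment_def using assms
    by (intro Bochner_Integration.integral_cong; simp add: jacobi_weight_eq_selberg_weight)+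
  then show ?thesis
    by (simp only: jacobi_avg_def)
qed

lemma powr_neg_two_coordinate:
  assumes "x \<in> space (jacobi_measure n)"
  shows "x 0 powr (-2) = 1 / (x 0)\<^sup>2"
  using space_jacobi_measureD[OF assms, of 0] n_ge_1 by (simp add: powr_minus_divide powr_numeral)

lemma integrable_weight: "integrable (jacobi_measure n) weight"
  using integrable_jacobi_weight
  by (simp add: jacobi_weight_eq_selberg_weight cong: Bochner_Integration.integrable_cong)

lemma integrable_inverse_square:
  assumes "i < n"
  shows "integrable (jacobi_measure n) (\<lambda>x. weight x * (1 / (x i)\<^sup>2))"
proof -
  have permutes: "Transposition.transpose 0 i permutes {..<n}"
    using n_ge_1 assms by (intro permutes_swap_id) auto
  have "integrable (jacobi_measure n) (\<lambda>x. weight x * (1 / (x 0)\<^sup>2))"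
    using integrable_powr_jacobi_weight
    by (simp add: jacobi_weight_eq_selberg_weight powr_neg_two_coordinate
        cong: Bochner_Integration.integrable_cong)
  then show ?thesis
    using n_ge_1 measurable_coordinate[of 0 n]
    by (subst integrable_selberg_weight_permute[where e = exponent and F = "\<lambda>x. 1 / (x 0)\<^sup>2",
          OF permutes jacobi_exponent_permute[OF permutes]]) simp_all
qed

lemma moment_permute:
  assumes "\<pi> permutes {..<n}" "F \<in> borel_measurable (jacobi_measure n)"
    and "\<And>x. F (\<lambda>j\<in>{..<n}. x (\<pi> j)) = G x"
  shows "moment G = moment F"
  unfolding moment_def
  by (rule integral_selberg_weight_permute[where e = exponent,
        OF assms(1) jacobi_exponent_permute[OF assms(1)] assms(2,3)])

lemma moment_coordinate:
  assumes "i < n" "f \<in> borel_measurable borel"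
  shows "moment (\<lambda>x. f (x i)) = moment (\<lambda>x. f (x 0))"
proof (rule moment_permute)
  show "Transposition.transpose 0 i permutes {..<n}"
    using n_ge_1 assms by (intro permutes_swap_id) auto
  show "(\<lambda>x. f (x 0)) \<in> borel_measurable (jacobi_measure n)"
    using n_ge_1 assms(2) by (intro measurable_compose[OF measurable_coordinate]) simp_all
qed (use n_ge_1 in simp)

lemma moment_inverse: "i < n \<Longrightarrow> moment (\<lambda>x. 1 / x i) = inverse_moment"
  unfolding inverse_moment_def by (rule moment_coordinate) simp_all

lemma moment_inverse_square: "i < n \<Longrightarrow> moment (\<lambda>x. 1 / (x i)\<^sup>2) = inverse_square_moment"
  unfolding inverse_square_moment_def by (rule moment_coordinate) simp_all

lemma moment_inverse_product:
  assumes indices: "i < n" "j < n" "i \<noteq> j"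
  shows "moment (\<lambda>x. 1 / (x i * x j)) = inverse_product_moment"
  unfolding inverse_product_moment_def
proof (rule moment_permute)
  let ?\<tau> = "Transposition.transpose 0 i"
  define \<sigma> where "\<sigma> = Transposition.transpose 1 (?\<tau> j)"
  have n_gt: "0 < n" "1 < n"
    using indices by linarith+
  have \<tau>_permutes: "?\<tau> permutes {..<n}"
    using n_gt indices by (intro permutes_swap_id) auto
  then have "\<sigma> permutes {..<n}"
    unfolding \<sigma>_def using n_gt indices permutes_in_image[OF \<tau>_permutes, of j]
    by (intro permutes_swap_id) auto
  then show "?\<tau> \<circ> \<sigma> permutes {..<n}"
    using \<tau>_permutes by (rule permutes_compose)
  have "\<sigma> 1 = ?\<tau> j"
    by (simp add: \<sigma>_def)
  moreover have "\<sigma> 0 = 0"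
    using indices(3) by (auto simp: \<sigma>_def Transposition.transpose_def)
  ultimately show "1 / ((\<lambda>j\<in>{..<n}. x ((?\<tau> \<circ> \<sigma>) j)) 0 * (\<lambda>j\<in>{..<n}. x ((?\<tau> \<circ> \<sigma>) j)) 1)
      = 1 / (x i * x j)" for x :: "nat \<Rightarrow> real"
    using n_gt by simp
  show "(\<lambda>x. 1 / (x 0 * x 1)) \<in> borel_measurable (jacobi_measure n)"
    using n_gt by (intro borel_measurable_divide borel_measurable_times measurable_coordinate
        borel_measurable_const)
qed

lemma moment_one_pos: "0 < moment (\<lambda>_. 1)"
  using integral_selberg_weight_pos[OF integrable_weight] by (simp add: moment_def)

lemma inverse_moment_eq:
  "(\<alpha> - 1) * inverse_moment = (\<alpha> + \<beta> + (real n - 1) * \<gamma> - 1) * moment (\<lambda>_. 1)"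
proof -
  have "(\<Sum>i<n. exponent i n * moment (\<lambda>x. 1 / x i))
      = (\<Sum>i<n. \<Sum>j<n + 2. exponent i j) * moment (\<lambda>_. 1)"
    unfolding moment_def mult_1_right
    by (rule selberg_inverse_relation[OF jacobi_exponent_simps(1) integrable_weight
          integrable_selberg_weight_inverse[OF _ integrable_inverse_square]])
  also have "(\<Sum>i<n. exponent i n * moment (\<lambda>x. 1 / x i)) = (\<Sum>i<n. (\<alpha> - 1) * inverse_moment)"
    by (intro sum.cong) (simp_all add: jacobi_exponent_simps moment_inverse)
  finally show ?thesis
    using n_ge_1 by (simp add: sum_jacobi_exponent mult.assoc del: sum.lessThan_Suc add_2_eq_Suc')
qed

lemma sum_exponent_moment_inverse_product:
  assumes "i < n"
  shows "(\<Sum>j<n. exponent i j * moment (\<lambda>x. 1 / (x i * x j)))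
    = inverse_square_moment + \<gamma> * (real n - 1) * inverse_product_moment"
proof -
  have "(\<Sum>j\<in>{..<n} - {i}. moment (\<lambda>x. 1 / (x i * x j))) = (\<Sum>j\<in>{..<n} - {i}. inverse_product_moment)"
    using assms by (intro sum.cong moment_inverse_product) auto
  moreover have "moment (\<lambda>x. 1 / (x i * x i)) = inverse_square_moment"
    using moment_inverse_square[OF assms] by (simp add: power2_eq_square)
  ultimately show ?thesis
    using assms n_ge_1 by (simp add: sum_jacobi_exponent_row of_nat_diff)
qed

lemma inverse_square_moment_eq:
  "(\<alpha> - 2) * inverse_square_moment
    = (\<alpha> + \<beta> - 2) * inverse_moment + \<gamma> * (real n - 1) * inverse_product_moment"
proof -
  have "(\<Sum>i<n. exponent i n * moment (\<lambda>x. 1 / (x i)\<^sup>2))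
      = (\<Sum>i<n. (exponent i n + exponent i (Suc n)) * moment (\<lambda>x. 1 / x i))
      + (\<Sum>i<n. \<Sum>j<n. exponent i j * moment (\<lambda>x. 1 / (x i * x j)))"
    unfolding moment_def
    by (rule selberg_inverse_square_relation[OF jacobi_exponent_simps(1) integrable_weight
          integrable_inverse_square])
  also have "(\<Sum>i<n. exponent i n * moment (\<lambda>x. 1 / (x i)\<^sup>2))
      = (\<Sum>i<n. (\<alpha> - 1) * inverse_square_moment)"
    by (intro sum.cong) (simp_all add: jacobi_exponent_simps moment_inverse_square)
  also have "(\<Sum>i<n. (exponent i n + exponent i (Suc n)) * moment (\<lambda>x. 1 / x i))
      = (\<Sum>i<n. (\<alpha> + \<beta> - 2) * inverse_moment)"
    by (intro sum.cong) (simp_all add: jacobi_exponent_simps moment_inverse)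
  also have "(\<Sum>i<n. \<Sum>j<n. exponent i j * moment (\<lambda>x. 1 / (x i * x j)))
      = (\<Sum>i<n. inverse_square_moment + \<gamma> * (real n - 1) * inverse_product_moment)"
    by (intro sum.cong sum_exponent_moment_inverse_product) simp_all
  finally have "real n * ((\<alpha> - 1) * inverse_square_moment) = real n * ((\<alpha> + \<beta> - 2) * inverse_moment
      + (inverse_square_moment + \<gamma> * (real n - 1) * inverse_product_moment))"
    by (simp add: distrib_left)
  then have "(\<alpha> - 1) * inverse_square_moment = (\<alpha> + \<beta> - 2) * inverse_moment
      + (inverse_square_moment + \<gamma> * (real n - 1) * inverse_product_moment)"
    using n_ge_1 by simp
  then show ?thesis
    by algebra
qed

lemma selberg_weight_shift_origin:
  assumes "x \<in> space (jacobi_measure n)"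
  shows "selberg_weight n (shift_exponent 0 n s exponent) x = x 0 powr s * weight x"
proof -
  have "(0, n) \<in> node_pairs n"
    using n_ge_1 by (simp add: node_pairs_def)
  then show ?thesis
    using space_jacobi_measureD[OF assms, of 0] n_ge_1
    by (simp add: selberg_weight_shift_exponent node_def)
qed

lemma shifted_inverse_relation:
  "(\<Sum>i<n. shift_exponent 0 n (- 1) exponent i n * moment (\<lambda>x. 1 / (x 0 * x i)))
    = (\<Sum>i<n. \<Sum>j<n + 2. shift_exponent 0 n (- 1) exponent i j) * inverse_moment"
proof -
  let ?M = "jacobi_measure n" and ?e = "shift_exponent 0 n (- 1) exponent"
  let ?V = "selberg_weight n ?e"
  have V_eq: "?V x = weight x * (1 / x 0)" if "x \<in> space ?M" for x
    using space_jacobi_measureD[OF that, of 0] n_ge_1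
    by (simp add: selberg_weight_shift_origin[OF that] powr_minus_divide)
  have V_inverse_eq: "?V x * (1 / x i) = weight x * (1 / (x 0 * x i))" if "x \<in> space ?M" for x i
    using V_eq[OF that] by simp
  have "integrable ?M ?V"
    using n_ge_1 by (subst Bochner_Integration.integrable_cong[OF refl V_eq])
      (auto intro!: integrable_selberg_weight_inverse integrable_inverse_square
        simp del: times_divide_eq_right)
  moreover have "integrable ?M (\<lambda>x. ?V x * (1 / x i))" if "i < n" for i
    using n_ge_1 that by (subst Bochner_Integration.integrable_cong[OF refl V_inverse_eq])
      (auto intro!: integrable_selberg_weight_inverse_product integrable_inverse_square
        simp del: times_divide_eq_right)
  moreover have "?e i i = 1" if "i < n" for i
    using that by (simp add: shift_exponent_def jacobi_exponent_simps)
  ultimately have "(\<Sum>i<n. ?e i n * (\<integral>x. ?V x * (1 / x i) \<partial>?M))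
      = (\<Sum>i<n. \<Sum>j<n + 2. ?e i j) * (\<integral>x. ?V x \<partial>?M)"
    by (intro selberg_inverse_relation)
  moreover have "(\<integral>x. ?V x * (1 / x i) \<partial>?M) = moment (\<lambda>x. 1 / (x 0 * x i))" for i
    unfolding moment_def by (intro Bochner_Integration.integral_cong V_inverse_eq refl)
  moreover have "(\<integral>x. ?V x \<partial>?M) = inverse_moment"
    unfolding inverse_moment_def moment_def by (intro Bochner_Integration.integral_cong V_eq refl)
  ultimately show ?thesis
    by (simp only:)
qed

lemma inverse_product_moment_eq:
  "(\<alpha> - 2) * inverse_square_moment + (\<alpha> - 1) * (real n - 1) * inverse_product_moment
    = (real n * (\<alpha> + \<beta> + (real n - 1) * \<gamma> - 1) - 1) * inverse_moment"
proof -
  let ?e = "shift_exponent 0 n (- 1) exponent"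
  have "(\<Sum>i<n. ?e i n * moment (\<lambda>x. 1 / (x 0 * x i))) = (\<alpha> - 2) * inverse_square_moment +
      (\<Sum>i\<in>{..<n} - {0}. ?e i n * moment (\<lambda>x. 1 / (x 0 * x i)))"
    using n_ge_1 by (subst sum.remove[of _ 0])
      (auto simp: shift_exponent_def jacobi_exponent_simps moment_inverse_square
        simp flip: power2_eq_square)
  also have "(\<Sum>i\<in>{..<n} - {0}. ?e i n * moment (\<lambda>x. 1 / (x 0 * x i)))
      = (\<Sum>i\<in>{..<n} - {0}. (\<alpha> - 1) * inverse_product_moment)"
    using n_ge_1 by (intro sum.cong arg_cong2[of _ _ _ _ "(*)"] moment_inverse_product)
      (auto simp: shift_exponent_def jacobi_exponent_simps)
  also have "\<dots> = (\<alpha> - 1) * (real n - 1) * inverse_product_moment"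
    using n_ge_1 by (simp add: of_nat_diff)
  also have "(\<Sum>i<n. ?e i n * moment (\<lambda>x. 1 / (x 0 * x i)))
      = (\<Sum>i<n. \<Sum>j<n + 2. ?e i j) * inverse_moment"
    by (rule shifted_inverse_relation)
  also have "(\<Sum>i<n. \<Sum>j<n + 2. ?e i j) = real n * (\<alpha> + \<beta> + (real n - 1) * \<gamma> - 1) - 1"
    using n_ge_1 by (subst sum_shift_exponent)
      (simp_all add: sum_jacobi_exponent del: sum.lessThan_Suc add_2_eq_Suc')
  finally show ?thesis by simp
qed

lemma alpha_gt_2: "2 < \<alpha>"
proof -
  have "integrable (jacobi_measure n) (selberg_weight n (shift_exponent 0 n (-2) exponent))"
    using integrable_powr_jacobi_weight
    by (simp add: selberg_weight_shift_origin jacobi_weight_eq_selberg_weight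
        cong: Bochner_Integration.integrable_cong)
  from integrable_selberg_weight_imp_pair_exponent_gt[OF this, of 0 n] show ?thesis
    using n_ge_1 by (simp add: pair_exponent_def shift_exponent_def jacobi_exponent_simps)
qed

lemma gamma_gt: "2 \<le> n \<Longrightarrow> - 1 / 2 < \<gamma>"
  using integrable_selberg_weight_imp_pair_exponent_gt[OF integrable_weight, of 0 1]
  by (simp add: pair_exponent_def jacobi_exponent_def)

lemma inverse_square_moment_ratio:
  "inverse_square_moment / moment (\<lambda>_. 1) =
    (\<alpha> + \<beta> + (real n - 1) * \<gamma> - 1) / ((\<alpha> - 1) * (\<alpha> - 2)) *
    (\<alpha> + \<beta> - 2 + \<gamma> * (real n - 1) * (\<alpha> + \<beta> + real n * \<gamma> - 1) / (\<alpha> + \<gamma> - 1))"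
proof -
  define q where
    "q = \<alpha> + \<beta> - 2 + \<gamma> * (real n - 1) * (\<alpha> + \<beta> + real n * \<gamma> - 1) / (\<alpha> + \<gamma> - 1)"
  have "(\<alpha> - 2) * inverse_square_moment = q * inverse_moment"
  proof (cases "n = 1")
    case True
    then show ?thesis
      using inverse_square_moment_eq by (simp add: q_def)
  next
    case False
    with n_ge_1 gamma_gt alpha_gt_2 have nonzero: "\<alpha> + \<gamma> - 1 \<noteq> 0" by simp
    have "(\<alpha> + \<gamma> - 1) * ((\<alpha> - 2) * inverse_square_moment)
        = ((\<alpha> + \<gamma> - 1) * (\<alpha> + \<beta> - 2) + \<gamma> * (real n - 1) * (\<alpha> + \<beta> + real n * \<gamma> - 1))
          * inverse_moment"
      using inverse_square_moment_eq inverse_product_moment_eq by algebra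
    also have "\<dots> = (\<alpha> + \<gamma> - 1) * (q * inverse_moment)"
      using nonzero by (simp add: q_def distrib_left distrib_right)
    finally show ?thesis
      using nonzero by simp
  qed
  then have "inverse_square_moment = q * inverse_moment / (\<alpha> - 2)"
    using alpha_gt_2 by (simp add: eq_divide_eq mult.commute)
  moreover have "inverse_moment = (\<alpha> + \<beta> + (real n - 1) * \<gamma> - 1) * moment (\<lambda>_. 1) / (\<alpha> - 1)"
    using inverse_moment_eq alpha_gt_2 by (simp add: eq_divide_eq mult.commute)
  ultimately show ?thesis
    unfolding q_def[symmetric] using moment_one_pos by (simp add: mult_ac)
qed

end

theorem theorem2:
  fixes n :: nat and \<alpha> \<beta> \<gamma> :: real
  assumes "n \<ge> 1"
    and "integrable (jacobi_measure n) (jacobi_weight n \<alpha> \<beta> \<gamma>)"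
    and "integrable (jacobi_measure n) (\<lambda>x. x 0 powr (-2) * jacobi_weight n \<alpha> \<beta> \<gamma> x)"
  shows "jacobi_avg n \<alpha> \<beta> \<gamma> (\<lambda>x. x 0 powr (-2)) =
    (\<alpha> + \<beta> + (real n - 1) * \<gamma> - 1) / ((\<alpha> - 1) * (\<alpha> - 2)) *
    (\<alpha> + \<beta> - 2 + \<gamma> * (real n - 1) * (\<alpha> + \<beta> + real n * \<gamma> - 1) / (\<alpha> + \<gamma> - 1))"
proof -
  interpret jacobi_inverse_square n \<alpha> \<beta> \<gamma>
    using assms by unfold_locales
  have "jacobi_avg n \<alpha> \<beta> \<gamma> (\<lambda>x. x 0 powr (-2)) = inverse_square_moment / moment (\<lambda>_. 1)"
    unfolding inverse_square_moment_def
    by (rule jacobi_avg_eq_moment) (rule powr_neg_two_coordinate)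
  then show ?thesis
    by (simp only: inverse_square_moment_ratio)
qed

end
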